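(* For $m\in\mathbb{N}$ we have: (a) $\mathrm{MARS}_m\cap[0,\infty)=[0,1)$. (b) $(-m,0)\subseteq\mathrm{MARS}_m$, hence $(-\infty,0)\subseteq\mathrm{MARS}$. (c) $\mathrm{MARS}\subseteq\{z\in\mathbb{C}:\operatorname{Re}z<1\}$. (d) $\mathrm{MARS}_m^-=\{\overline{a}: a\in\mathrm{MARS}_m^+\}$. (e) $\mathrm{MARS}_m$ is open. (f) $\mathrm{MARS}_m$ is semi-algebraic in $\mathbb{C}$, and $\mathrm{MARS}$ is semi-analytic but not semi-algebraic.
   Context: $\mathbb{N}=\{1,2,\dots\}$. For $m\in\mathbb{N}$ and $a\in\mathbb{C}$, $\mathcal{M}_m(a)\in\mathbb{C}^{m\times m}$ is the matrix whose $i$-th row, for $1\le i\le m-1$, has entry $1$ in column $i+1$ and zeros elsewhere, and whose last row has all entries equal to $\frac{a}{m}$. $\sigma(\cdot)$ denotes the spectrum and $B_1(0)=\{z\in\mathbb{C}:|z|<1\}$. $\mathrm{MARS}_m:=\{a\in\mathbb{C}:\sigma(\mathcal{M}_m(a))\subseteq B_1(0)\}$, $\mathrm{MARS}:=\bigcup_{m\in\mathbb{N}}\mathrm{MARS}_m$, $\mathrm{MARS}_m^+:=\{a\in\mathrm{MARS}_m:\operatorname{Im}(a)>0\}$ and $\mathrm{MARS}_m^-:=\{a\in\mathrm{MARS}_m:\operatorname{Im}(a)<0\}$. A subset of $\mathbb{C}$ is called semi-algebraic (semi-analytic) if it is so as a subset of $\mathbb{R}^2$ under the standard identification $\mathbb{C}\cong\mathbb{R}^2$.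 *)

theory Defs
  imports "HOL-Analysis.Analysis" "Jordan_Normal_Form.Spectral_Radius"
begin

text \<open>Rows and columns are numbered from 0, so the last row is row \<open>m - 1\<close>.\<close>

definition MARS_matrix :: "nat \<Rightarrow> complex \<Rightarrow> complex mat" where
  "MARS_matrix m a =
     mat m m (\<lambda>(i, j). if i = m - 1 then a / of_nat m else if j = i + 1 then 1 else 0)"

definition MARS_at :: "nat \<Rightarrow> complex set" where
  "MARS_at m = {a. spectrum (MARS_matrix m a) \<subseteq> ball 0 1}"

definition MARS :: "complex set" where
  "MARS = (\<Union>m\<in>{1..}. MARS_at m)"

definition MARS_plus :: "nat \<Rightarrow> complex set" where
  "MARS_plus m = {a \<in> MARS_at m. Im a > 0}"

definition MARS_minus :: "nat \<Rightarrow> complex set" where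
  "MARS_minus m = {a \<in> MARS_at m. Im a < 0}"

text \<open>
  \<open>S\<close> is a finite union of sets cut out of \<open>U\<close> by finitely many equations \<open>f = 0\<close> and
  finitely many strict inequalities \<open>g > 0\<close> with \<open>f\<close>, \<open>g\<close> from the class \<open>C\<close> of functions.
\<close>

definition sign_described :: "('a \<Rightarrow> real) set \<Rightarrow> 'a set \<Rightarrow> 'a set \<Rightarrow> bool" where
  "sign_described C U S \<longleftrightarrow>
     (\<exists>\<B>. finite \<B> \<and> S = \<Union>\<B> \<and>
        (\<forall>B\<in>\<B>. \<exists>F G. finite F \<and> finite G \<and> F \<subseteq> C \<and> G \<subseteq> C \<and>
           B = {x \<in> U. (\<forall>f\<in>F. f x = 0) \<and> (\<forall>g\<in>G. g x > 0)}))"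

definition semialgebraic :: "(real \<times> real) set \<Rightarrow> bool" where
  "semialgebraic S \<longleftrightarrow> sign_described {f. real_polynomial_function f} UNIV S"

text \<open>
  Real analyticity: around each point of \<open>U\<close> the function is the sum of a double power series.
  For real families, summability in the sense of \<open>has_sum\<close> is absolute convergence.
\<close>

definition real_analytic_on :: "(real \<times> real \<Rightarrow> real) \<Rightarrow> (real \<times> real) set \<Rightarrow> bool" where
  "real_analytic_on f U \<longleftrightarrow>
     (\<forall>p\<in>U. \<exists>r>0. \<exists>c :: nat \<times> nat \<Rightarrow> real. \<forall>q\<in>ball p r.
        ((\<lambda>(i, j). c (i, j) * (fst q - fst p) ^ i * (snd q - snd p) ^ j) has_sum f q) UNIV)"

text \<open>
  Semi-analyticity is local at every point of the plane, including points outside \<open>S\<close>.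
\<close>

definition semianalytic :: "(real \<times> real) set \<Rightarrow> bool" where
  "semianalytic S \<longleftrightarrow>
     (\<forall>p. \<exists>U. open U \<and> p \<in> U \<and> sign_described {f. real_analytic_on f U} U (S \<inter> U))"

definition complex_to_plane :: "complex \<Rightarrow> real \<times> real" where
  "complex_to_plane z = (Re z, Im z)"

definition semialgebraic_complex :: "complex set \<Rightarrow> bool" where
  "semialgebraic_complex A \<longleftrightarrow> semialgebraic (complex_to_plane ` A)"

definition semianalytic_complex :: "complex set \<Rightarrow> bool" where
  "semianalytic_complex A \<longleftrightarrow> semianalytic (complex_to_plane ` A)"

end

theory Submission
  imports Defs "HOL-Complex_Analysis.Conformal_Mappings" "HOL-Real_Asymp.Real_Asymp"
begin

unbundle no vec_syntax

text \<open>
  The eigenvalues of the matrix are the roots of \<open>p z = z ^ m - a / m * (\<Sum>k<m. z ^ k)\<close>. If they all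
  lie in the open unit disc, then \<open>Re (z p' z / p z) \<ge> m / 2\<close> on the unit circle. At \<open>z = 1\<close>
  this gives \<open>Re a < 1\<close>; at a unimodular root for the parameter \<open>a\<close> it shows that no
  \<open>t a\<close> with \<open>t \<ge> 1\<close> is admissible. On the ray of argument \<open>\<psi>\<close> the nearest parameter with a unimodular
  root \<open>exp (2 \<i> u)\<close> has \<open>u = \<psi> / (m + 1)\<close>, and its modulus tends to its upper bound
  \<open>\<psi> / sin \<psi>\<close> as \<open>m\<close> grows. Hence the upper half of \<open>MARS\<close> is given by \<open>Im a < Arg a\<close>, that is, by
  \<open>y < \<pi>\<close> and \<open>x < y cot y\<close>. This set is semianalytic, and not semialgebraic because the curve
  \<open>x = y cot y\<close> is transcendental. For fixed \<open>m\<close> the Schur--Cohn recursion describes \<open>MARS\<^sub>m\<close> by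
  polynomial inequalities.
\<close>

section \<open>The characteristic equation\<close>

text \<open>The shift rows force every eigenvector to be a multiple of (1, z, ..., z^(m-1)); the
  last row then becomes the equation for z.\<close>

lemma eigenvalue_MARS_matrix:
  assumes "m \<ge> 1"
  shows "eigenvalue (MARS_matrix m a) z \<longleftrightarrow> z ^ m = a / of_nat m * (\<Sum>k<m. z ^ k)"
proof -
  have dim: "dim_row (MARS_matrix m a) = m" "dim_col (MARS_matrix m a) = m"
    by (auto simp: MARS_matrix_def)
  have row: "(MARS_matrix m a *\<^sub>v v) $ i =
      (if i = m - 1 then a / of_nat m * (\<Sum>k<m. v $ k) else v $ (i + 1))"
    if "v \<in> carrier_vec m" "i < m" for v i
  proof -
    have "(MARS_matrix m a *\<^sub>v v) $ i =
        (\<Sum>k<m. (if i = m - 1 then a / of_nat m else if k = i + 1 then 1 else 0) * v $ k)"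
      using that by (auto simp: MARS_matrix_def scalar_prod_def atLeast0LessThan intro!: sum.cong)
    also have "\<dots> = (if i = m - 1 then a / of_nat m * (\<Sum>k<m. v $ k) else v $ (i + 1))"
      using that by (auto simp: sum_distrib_left if_distrib[of "\<lambda>x. x * _"] cong: if_cong)
    finally show ?thesis .
  qed
  show ?thesis
  proof
    assume "eigenvalue (MARS_matrix m a) z"
    then obtain v where v: "v \<in> carrier_vec m" "v \<noteq> 0\<^sub>v m" "MARS_matrix m a *\<^sub>v v = z \<cdot>\<^sub>v v"
      by (auto simp: eigenvalue_def eigenvector_def dim)
    have zv: "(MARS_matrix m a *\<^sub>v v) $ i = z * v $ i" if "i < m" for i
      using v that by auto
    have pow: "v $ i = z ^ i * v $ 0" if "i < m" for i
      using that
    proof (induction i)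
      case (Suc i)
      then show ?case using zv[of i] row[OF v(1), of i] by (auto split: if_splits)
    qed auto
    have nz: "v $ 0 \<noteq> 0"
    proof
      assume "v $ 0 = 0"
      then have "v = 0\<^sub>v m" using pow v(1) by (intro eq_vecI) auto
      with v(2) show False by simp
    qed
    have "z * (z ^ (m - 1) * v $ 0) = a / of_nat m * (\<Sum>k<m. z ^ k * v $ 0)"
      using zv[of "m - 1"] row[OF v(1), of "m - 1"] assms pow[of "m - 1"]
        sum.cong[OF refl pow, of "{..<m}"] by auto
    then have "v $ 0 * z ^ m = v $ 0 * (a / of_nat m * (\<Sum>k<m. z ^ k))"
      using assms by (cases m) (auto simp: sum_distrib_left sum_divide_distrib algebra_simps)
    with nz show "z ^ m = a / of_nat m * (\<Sum>k<m. z ^ k)"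
      by (metis mult_left_cancel)
  next
    assume eq: "z ^ m = a / of_nat m * (\<Sum>k<m. z ^ k)"
    define v where "v = vec m (\<lambda>i. z ^ i)"
    have "v $ 0 = 1" using assms by (auto simp: v_def)
    then have "v \<noteq> 0\<^sub>v m" using assms by auto
    moreover have "MARS_matrix m a *\<^sub>v v = z \<cdot>\<^sub>v v"
    proof (rule eq_vecI)
      fix i assume "i < dim_vec (z \<cdot>\<^sub>v v)"
      then have i: "i < m" by (simp add: v_def)
      have "(MARS_matrix m a *\<^sub>v v) $ i = z ^ Suc i"
        using row[of v i] i eq assms by (cases m) (auto simp: v_def)
      then show "(MARS_matrix m a *\<^sub>v v) $ i = (z \<cdot>\<^sub>v v) $ i"
        using i by (simp add: v_def)
    qed (simp_all add: v_def dim)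
    ultimately show "eigenvalue (MARS_matrix m a) z"
      using v_def by (auto simp: eigenvalue_def eigenvector_def dim intro!: exI[of _ v])
  qed
qed

definition mars_poly :: "nat \<Rightarrow> complex \<Rightarrow> complex \<Rightarrow> complex" where
  "mars_poly m a z = z ^ m - a / of_nat m * (\<Sum>k<m. z ^ k)"

lemma MARS_at_iff:
  assumes "m \<ge> 1"
  shows "a \<in> MARS_at m \<longleftrightarrow> (\<forall>z. mars_poly m a z = 0 \<longrightarrow> norm z < 1)"
  unfolding MARS_at_def mars_poly_def spectrum_def using eigenvalue_MARS_matrix[OF assms]
  by auto

text \<open>The factor z - 1 collapses the geometric sum, leaving an equation whose modulus and
  argument can be compared; its price is the extra root 1.\<close>

lemma mars_poly_times:
  "(z - 1) * mars_poly m a z = z ^ m * (z - 1 - a / of_nat m) + a / of_nat m"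
proof -
  have "(z - 1) * mars_poly m a z = (z - 1) * z ^ m - a / of_nat m * ((z - 1) * (\<Sum>k<m. z ^ k))"
    by (simp add: mars_poly_def right_diff_distrib mult.left_commute)
  also have "(z - 1) * (\<Sum>k<m. z ^ k) = z ^ m - 1"
    by (rule power_diff_1_eq[symmetric])
  finally show ?thesis by (simp add: algebra_simps)
qed

section \<open>Complex polynomials with all roots in the open unit disc\<close>

lemma norm_reflected_root_le:
  fixes w z :: complex
  assumes "norm w < 1" "norm z \<ge> 1"
  shows "norm (1 - w * cnj z) \<le> norm (z - w)"
proof -
  \<comment> \<open>This product is exactly the difference of the two squared moduli.\<close>
  have "0 \<le> ((norm z)\<^sup>2 - 1) * (1 - (norm w)\<^sup>2)"
    using assms by (intro mult_nonneg_nonneg) (auto simp: power_le_one one_le_power)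
  also have "\<dots> = (norm (z - w))\<^sup>2 - (norm (1 - w * cnj z))\<^sup>2"
    unfolding cmod_power2 by (simp add: algebra_simps power2_eq_square)
  finally have "(norm (1 - w * cnj z))\<^sup>2 \<le> (norm (z - w))\<^sup>2" by simp
  then show ?thesis by (rule power2_le_imp_le) simp
qed

text \<open>The derivative is expressed through the same multiset of roots, so that p and p' can be
  treated together by induction on \<open>A\<close>.\<close>

lemma complex_poly_factorization:
  fixes p :: "complex poly"
  assumes "p \<noteq> 0"
  shows "\<exists>A. size A = degree p \<and> (\<forall>z. poly p z = lead_coeff p * (\<Prod>x\<in>#A. z - x)) \<and>
    (\<forall>z. poly (pderiv p) z = lead_coeff p * poly (pderiv (\<Prod>x\<in>#A. [:-x, 1:])) z)"
proof -
  obtain A where A: "size A = degree p \<and> p = Polynomial.smult (lead_coeff p) (\<Prod>x\<in>#A. [:-x, 1:])"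
    using alg_closed_imp_factorization[OF assms] ..
  note eq = arg_cong[OF conjunct2[OF A]]
  show ?thesis
  proof (intro exI conjI allI)
    show "size A = degree p" using A ..
    show "poly p z = lead_coeff p * (\<Prod>x\<in>#A. z - x)" for z
      using eq[of "\<lambda>p. poly p z"] by (simp only: poly_smult poly_prod_mset) simp
    show "poly (pderiv p) z = lead_coeff p * poly (pderiv (\<Prod>x\<in>#A. [:-x, 1:])) z" for z
      using eq[of "\<lambda>p. poly (pderiv p) z"] by (simp only: poly_smult pderiv_smult)
  qed
qed

text \<open>Compare factor by factor: z * (1 / cnj z - x) has the modulus of 1 - x * cnj z, to which
  \<open>norm_reflected_root_le\<close> applies.\<close>

lemma poly_norm_reflected_le:
  fixes p :: "complex poly"
  assumes roots: "\<And>w. poly p w = 0 \<Longrightarrow> norm w < 1" and z: "norm z \<ge> 1"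
  shows "norm (z ^ degree p * poly p (1 / cnj z)) \<le> norm (poly p z)"
proof (cases "p = 0")
  case False
  obtain A where A: "size A = degree p"
    and poly: "\<And>z. poly p z = lead_coeff p * (\<Prod>x\<in>#A. z - x)"
    using complex_poly_factorization[OF False] by blast
  have "norm w < 1" if "w \<in># A" for w
    using roots[of w] that unfolding poly by auto
  then have "norm (z ^ size A * (\<Prod>x\<in>#A. 1 / cnj z - x)) \<le> norm (\<Prod>x\<in>#A. z - x)"
  proof (induction A)
    case (add x A)
    have x: "norm x < 1" and IH: "norm (z ^ size A * (\<Prod>x\<in>#A. 1 / cnj z - x)) \<le> norm (\<Prod>x\<in>#A. z - x)"
      using add by simp_all
    have "cnj z * (1 / cnj z - x) = 1 - x * cnj z"
      using z by (auto simp: right_diff_distrib)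
    moreover have "norm (z * (1 / cnj z - x)) = norm (cnj z * (1 / cnj z - x))"
      by (simp only: norm_mult complex_mod_cnj)
    ultimately have "norm (z * (1 / cnj z - x)) \<le> norm (z - x)"
      using norm_reflected_root_le[OF x z] by simp
    from mult_mono[OF this IH] show ?case
      by (simp add: norm_mult mult.left_commute mult.assoc)
  qed simp
  then have "norm (lead_coeff p) * norm (z ^ size A * (\<Prod>x\<in>#A. 1 / cnj z - x))
      \<le> norm (lead_coeff p) * norm (\<Prod>x\<in>#A. z - x)"
    by (rule mult_left_mono) simp
  then show ?thesis
    by (simp only: poly A norm_mult mult.left_commute)
qed simp

text \<open>z p'(z) / p(z) is the sum of z / (z - x) over the roots x, and w |-> 1 / (1 - w) maps
  the unit disc into the half-plane Re > 1/2.\<close>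

lemma Re_logarithmic_derivative_ge:
  fixes p :: "complex poly"
  assumes roots: "\<And>w. poly p w = 0 \<Longrightarrow> norm w < 1" and z: "norm z = 1"
  shows "real (degree p) / 2 \<le> Re (z * poly (pderiv p) z / poly p z)"
proof (cases "p = 0")
  case False
  obtain A where A: "size A = degree p"
    and p: "\<And>z. poly p z = lead_coeff p * (\<Prod>x\<in>#A. z - x)"
    and pderiv: "\<And>z. poly (pderiv p) z = lead_coeff p * poly (pderiv (\<Prod>x\<in>#A. [:-x, 1:])) z"
    using complex_poly_factorization[OF False] by blast
  define q where "q B = (\<Prod>x\<in>#B. [:-x, 1:])" for B :: "complex multiset"
  have poly: "poly (q B) w = (\<Prod>x\<in>#B. w - x)" for w B
    by (simp add: poly_prod_mset q_def)
  have "norm w < 1" if "w \<in># A" for w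
    using roots[of w] that by (auto simp: p poly)
  then have "poly (q A) z \<noteq> 0 \<and> real (size A) / 2 \<le> Re (z * poly (pderiv (q A)) z / poly (q A) z)"
  proof (induction A)
    case (add x A)
    have zx: "z \<noteq> x" using add.prems[of x] z by auto
    have q: "q (add_mset x A) = [:-x, 1:] * q A" by (simp add: q_def)
    have "z * poly (pderiv (q (add_mset x A))) z =
        z * poly (q A) z + (z - x) * (z * poly (pderiv (q A)) z)"
      unfolding q by (simp only: pderiv_mult) (simp add: pderiv_pCons algebra_simps)
    moreover have "poly (q (add_mset x A)) z = (z - x) * poly (q A) z"
      by (simp add: q left_diff_distrib)
    ultimately have "z * poly (pderiv (q (add_mset x A))) z / poly (q (add_mset x A)) z =
        z / (z - x) + z * poly (pderiv (q A)) z / poly (q A) z"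
      using zx add by (simp add: divide_simps)
    moreover have "1 / 2 \<le> Re (z / (z - x))"
    proof -
      have "(norm (z - x))\<^sup>2 - 2 * Re (z * cnj (z - x)) = (norm x)\<^sup>2 - (norm z)\<^sup>2"
        unfolding cmod_power2 by (simp add: algebra_simps power2_eq_square)
      also have "\<dots> \<le> 0" using z add.prems[of x] by (simp add: power_le_one)
      finally have "(norm (z - x))\<^sup>2 \<le> 2 * Re (z * cnj (z - x))" by simp
      moreover have "Re (z / (z - x)) = Re (z * cnj (z - x)) / (norm (z - x))\<^sup>2"
        by (subst complex_div_cnj) (simp add: Re_divide_of_real flip: of_real_power)
      moreover have "(norm (z - x))\<^sup>2 > 0" using zx by simp
      ultimately show ?thesis by (simp add: le_divide_eq)
    qed
    moreover have "poly (q (add_mset x A)) z \<noteq> 0"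
      using add zx by (simp add: q)
    ultimately show ?case using add by (simp add: add_divide_distrib)
  qed (simp add: q_def)
  then show ?thesis using False A by (simp add: p pderiv poly flip: q_def)
qed simp

section \<open>The characteristic polynomial and its logarithmic derivative on the unit
  circle\<close>

definition mars_polynomial :: "nat \<Rightarrow> complex \<Rightarrow> complex poly" where
  "mars_polynomial m a =
     Polynomial.monom 1 m - Polynomial.smult (a / of_nat m) (\<Sum>k<m. Polynomial.monom 1 k)"

lemma poly_mars_polynomial: "poly (mars_polynomial m a) z = mars_poly m a z"
  by (simp add: mars_polynomial_def mars_poly_def poly_sum poly_monom)

lemma
  assumes "m \<ge> 1"
  shows degree_mars_polynomial: "degree (mars_polynomial m a) = m"
    and lead_coeff_mars_polynomial: "lead_coeff (mars_polynomial m a) = 1"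
proof -
  have "degree (Polynomial.smult (a / of_nat m) (\<Sum>k<m. Polynomial.monom 1 k)) < m"
    using assms by (intro le_less_trans[OF degree_smult_le] degree_sum_less)
      (auto simp: degree_monom_eq)
  then show deg: "degree (mars_polynomial m a) = m"
    unfolding mars_polynomial_def
    by (subst diff_conv_add_uminus, subst degree_add_eq_left) (auto simp: degree_monom_eq)
  show "lead_coeff (mars_polynomial m a) = 1"
    unfolding deg by (simp add: mars_polynomial_def Polynomial.coeff_sum)
qed

lemma poly_pderiv_mars_polynomial:
  "z * poly (pderiv (mars_polynomial m a)) z
    = of_nat m * z ^ m - a / of_nat m * (\<Sum>k<m. of_nat k * z ^ k)"
proof -
  have kz: "of_nat k * (z * z ^ (k - Suc 0)) = of_nat k * z ^ k" for k
    by (cases k) (simp_all del: of_nat_Suc)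
  show ?thesis
    by (simp add: mars_polynomial_def pderiv_diff pderiv_smult pderiv_sum pderiv_monom poly_sum
        poly_monom right_diff_distrib sum_distrib_left mult.left_commute[of z] kz)
qed

lemma MARS_at_logarithmic_derivative:
  assumes "m \<ge> 1" "a \<in> MARS_at m" "norm z = 1"
  shows "real m / 2 \<le> Re ((of_nat m * z ^ m - a / of_nat m * (\<Sum>k<m. of_nat k * z ^ k)) / mars_poly m a z)"
  using Re_logarithmic_derivative_ge[of "mars_polynomial m a" z] assms MARS_at_iff[of m a]
  by (simp add: poly_mars_polynomial degree_mars_polynomial poly_pderiv_mars_polynomial)

text \<open>Every linear factor satisfies |z - x| >= |z| - 1. The bound does not depend on
  \<open>a\<close>, which lets it pass to limits of admissible parameters.\<close>

lemma norm_mars_poly_ge: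
  assumes m: "m \<ge> 1" and a: "a \<in> MARS_at m" and z: "norm z \<ge> 1"
  shows "(norm z - 1) ^ m \<le> norm (mars_poly m a z)"
proof -
  have "mars_polynomial m a \<noteq> 0"
    using degree_mars_polynomial[OF m, of a] m by auto
  from complex_poly_factorization[OF this] obtain A where A: "size A = m"
    and poly: "\<And>w. mars_poly m a w = (\<Prod>x\<in>#A. w - x)"
    unfolding lead_coeff_mars_polynomial[OF m]
    unfolding poly_mars_polynomial degree_mars_polynomial[OF m] by auto
  have "norm w < 1" if "w \<in># A" for w
    using a that unfolding MARS_at_iff[OF m] poly by auto
  then have "(norm z - 1) ^ size A \<le> norm (\<Prod>x\<in>#A. z - x)"
  proof (induction A)
    case (add x A)
    have "norm z - 1 \<le> norm (z - x)"
      using add.prems[of x] norm_triangle_ineq2[of z x] by simp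
    moreover have "(norm z - 1) ^ size A \<le> norm (\<Prod>x\<in>#A. z - x)"
      using add by simp
    ultimately have "(norm z - 1) * (norm z - 1) ^ size A \<le> norm (z - x) * norm (\<Prod>x\<in>#A. z - x)"
      using z by (intro mult_mono) auto
    then show ?case by (simp add: norm_mult)
  qed simp
  then show ?thesis by (simp add: poly A)
qed

text \<open>Serves in place of continuity of the roots: the lower bound of
  \<open>norm_mars_poly_ge\<close> is a closed condition on \<open>a\<close>, and it excludes roots
  with |z| > 1.\<close>

lemma closure_MARS_at_root_norm_le:
  assumes m: "m \<ge> 1" and a: "a \<in> closure (MARS_at m)" and root: "mars_poly m a z = 0"
  shows "norm z \<le> 1"
proof (rule ccontr)
  assume z: "\<not> norm z \<le> 1"
  have "closed {a. (norm z - 1) ^ m \<le> norm (mars_poly m a z)}"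
    unfolding mars_poly_def using m by (intro closed_Collect_le continuous_intros) auto
  moreover have "MARS_at m \<subseteq> {a. (norm z - 1) ^ m \<le> norm (mars_poly m a z)}"
    using norm_mars_poly_ge[OF m] z by auto
  ultimately have "(norm z - 1) ^ m \<le> norm (mars_poly m a z)"
    using a closure_minimal by blast
  then show False using z root by (auto simp: power_le_zero_eq not_le)
qed

text \<open>
  The coefficients of \<open>g = (\<Sum>k<m. z ^ k)\<close> are symmetric and those of
  \<open>h = (\<Sum>k<m. (2 k - (m - 1)) * z ^ k)\<close> are antisymmetric under \<open>k \<mapsto> m - 1 - k\<close>. On the unit circle
  this means \<open>z ^ (m - 1) * cnj g = g\<close> and \<open>z ^ (m - 1) * cnj h = - h\<close>, so \<open>h / g\<close> is imaginary.
\<close>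

lemma Re_geometric_logarithmic_derivative:
  fixes z :: complex
  assumes z: "norm z = 1" and g: "(\<Sum>k<m. z ^ k) \<noteq> 0"
  shows "Re ((\<Sum>k<m. of_nat k * z ^ k) / (\<Sum>k<m. z ^ k)) = (real m - 1) / 2"
proof -
  define g where "g = (\<Sum>k<m. z ^ k)"
  define s where "s = (\<Sum>k<m. of_nat k * z ^ k)"
  have cnj: "z ^ j * cnj (z ^ j) = 1" for j
    by (subst complex_norm_square[symmetric]) (simp add: norm_power z)
  have rev: "z ^ (m - Suc k) = z ^ (m - 1) * cnj (z ^ k)" if "k < m" for k
  proof -
    have "z ^ (m - 1) = z ^ (m - Suc k) * z ^ k"
      using that by (simp flip: power_add)
    then show ?thesis using cnj[of k] by (simp add: mult.assoc)
  qed
  have "g = (\<Sum>k<m. z ^ (m - Suc k))"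
    unfolding g_def by (rule sum.nat_diff_reindex[symmetric])
  also have "\<dots> = z ^ (m - 1) * cnj g"
    unfolding g_def cnj_sum sum_distrib_left by (intro sum.cong refl rev) simp
  finally have gg: "g = z ^ (m - 1) * cnj g" .
  have "s = (\<Sum>k<m. of_nat (m - Suc k) * z ^ (m - Suc k))"
    unfolding s_def by (rule sum.nat_diff_reindex[symmetric])
  also have "\<dots> = (\<Sum>k<m. (of_nat m - 1) * (z ^ (m - 1) * cnj (z ^ k)) - z ^ (m - 1) * cnj (of_nat k * z ^ k))"
  proof (intro sum.cong refl)
    have eq: "(M - 1 - K) * (Z * C) = (M - 1) * (Z * C) - Z * (K * C)" for M K Z C :: complex
      by (simp add: algebra_simps)
    fix k assume "k \<in> {..<m}"
    then have k: "k < m" by simp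
    then have "of_nat (m - Suc k) = (of_nat m - 1 - of_nat k :: complex)"
      by (simp add: of_nat_diff)
    with rev[OF k] show "of_nat (m - Suc k) * z ^ (m - Suc k) =
        (of_nat m - 1) * (z ^ (m - 1) * cnj (z ^ k)) - z ^ (m - 1) * cnj (of_nat k * z ^ k)"
      by (simp only: complex_cnj_mult complex_cnj_of_nat eq)
  qed
  also have "\<dots> = (of_nat m - 1) * (z ^ (m - 1) * cnj g) - z ^ (m - 1) * cnj s"
    unfolding g_def s_def cnj_sum sum_distrib_left by (rule sum_subtractf)
  \<comment> \<open>Dividing by g = z^(m-1) * cnj g turns this into s/g + cnj (s/g) = m - 1, which
    fixes the real part.\<close>
  finally have "s = (of_nat m - 1) * g - z ^ (m - 1) * cnj s" using gg by simp
  then have "s / g = (of_nat m - 1) - z ^ (m - 1) * cnj s / g"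
    using g by (simp add: g_def[symmetric] field_simps)
  also have "z ^ (m - 1) * cnj s / g = cnj (s / g)"
  proof -
    have "g \<noteq> 0" using g by (simp add: g_def)
    moreover have "z ^ (m - 1) \<noteq> 0" using z by auto
    ultimately show ?thesis by (subst gg) (simp del: power_eq_0_iff)
  qed
  finally have "Re (s / g) = Re (of_nat m - 1 - cnj (s / g))" by (rule arg_cong)
  then have "Re (s / g) = (real m - 1) / 2" by (simp del: complex_cnj_divide)
  then show ?thesis by (simp only: s_def g_def)
qed

text \<open>At the fixed z the logarithmic derivative for the parameter t a has real part (m - t
  (m-1)/2) / (1 - t). For t > 1 the lower bound m/2 would force m + t <= 0; for t = 1 the root z
  itself rules out membership.\<close>

lemma not_MARS_at_beyond_unit_root:
  assumes m: "m \<ge> 1" and z: "norm z = 1" and root: "mars_poly m a z = 0" and t: "t \<ge> 1"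
  shows "of_real t * a \<notin> MARS_at m"
proof
  assume mem: "of_real t * a \<in> MARS_at m"
  define g where "g = (\<Sum>k<m. z ^ k)"
  define s where "s = (\<Sum>k<m. of_nat k * z ^ k)"
  have za: "z ^ m = a / of_nat m * g"
    using root by (simp add: mars_poly_def g_def)
  have z0: "z \<noteq> 0" using z by auto
  then have g0: "g \<noteq> 0" using za by auto
  have "t \<noteq> 1" using mem z root by (auto simp: MARS_at_iff[OF m])
  with t have t1: "t > 1" by simp
  have "mars_poly m (of_real t * a) z = z ^ m - of_real t * z ^ m"
    unfolding mars_poly_def za g_def by simp
  then have den: "mars_poly m (of_real t * a) z = of_real (1 - t) * z ^ m"
    by (simp add: algebra_simps)
  have "of_nat m * z ^ m - of_real t * a / of_nat m * s = z ^ m * (of_nat m - of_real t * (s / g))"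
    unfolding right_diff_distrib using g0 by (simp add: za)
  then have "(of_nat m * z ^ m - of_real t * a / of_nat m * s) / mars_poly m (of_real t * a) z
      = (of_nat m - of_real t * (s / g)) / of_real (1 - t)"
    unfolding den using z0 t1 by (simp add: divide_simps)
  then have "real m / 2 \<le> Re ((of_nat m - of_real t * (s / g)) / of_real (1 - t))"
    using MARS_at_logarithmic_derivative[OF m mem z] by (simp add: s_def)
  also have "\<dots> = (real m - t * ((real m - 1) / 2)) / (1 - t)"
  proof -
    have "Re (s / g) = (real m - 1) / 2"
      unfolding s_def g_def
      by (rule Re_geometric_logarithmic_derivative[OF z g0[unfolded g_def]])
    then show ?thesis
      by (subst Re_divide_of_real) (simp del: times_divide_eq_right)
  qed
  finally have "real m - t * ((real m - 1) / 2) \<le> real m / 2 * (1 - t)"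
    using t1 by (simp add: le_divide_eq)
  then show False using m t by (simp add: field_simps)
qed

text \<open>The logarithmic derivative at z = 1 is (m-1)/2 + (m+1)/2 * 1/(1-a). Real part at least
  m/2 makes Re (1/(1-a)) positive, and inversion preserves the right half-plane.\<close>

lemma Re_MARS_at_less:
  assumes m: "m \<ge> 1" and a: "a \<in> MARS_at m"
  shows "Re a < 1"
proof -
  have one: "mars_poly m a 1 = 1 - a"
    using m by (simp add: mars_poly_def)
  have a1: "a \<noteq> 1"
    using a one by (auto simp: MARS_at_iff[OF m])
  have "2 * (\<Sum>k<m. of_nat k) = (of_nat m * (of_nat m - 1) :: complex)"
    by (induction m) (auto simp: algebra_simps)
  then have sum: "(\<Sum>k<m. of_nat k) = (of_nat m * (of_nat m - 1) / 2 :: complex)"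
    by (simp add: field_simps)
  have "real m / 2 \<le> Re ((of_nat m - a * (of_nat m - 1) / 2) / (1 - a))"
    using MARS_at_logarithmic_derivative[OF m a, of 1] m by (simp add: one sum)
  also have "(of_nat m - a * (of_nat m - 1) / 2) / (1 - a) =
      of_real ((real m - 1) / 2) + of_real ((real m + 1) / 2) * (1 / (1 - a))"
    using a1 by (simp add: divide_simps) (simp add: algebra_simps)
  finally have "1 / 2 \<le> (real m + 1) / 2 * Re (1 / (1 - a))"
    by (simp only: plus_complex.sel Re_complex_of_real times_complex.sel Im_complex_of_real)
       (simp add: diff_divide_distrib)
  then have "0 < (real m + 1) / 2 * Re (1 / (1 - a))" by linarith
  then have "0 < Re (1 / (1 - a))" by (simp add: zero_less_mult_iff)
  moreover have "Re (1 / (1 - a)) = (1 - Re a) / ((1 - Re a)\<^sup>2 + (Im a)\<^sup>2)"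
    by (simp add: Re_divide)
  ultimately show ?thesis by (auto simp: zero_less_divide_iff not_less[symmetric] not_sum_power2_lt_zero)
qed

section \<open>Real parameters, conjugation and openness for fixed m\<close>

lemma MARS_at_nonneg_iff:
  assumes m: "m \<ge> 1" and x: "x \<ge> 0"
  shows "complex_of_real x \<in> MARS_at m \<longleftrightarrow> x < 1"
proof
  assume "complex_of_real x \<in> MARS_at m"
  from Re_MARS_at_less[OF m this] show "x < 1" by simp
next
  assume x1: "x < 1"
  show "complex_of_real x \<in> MARS_at m"
    unfolding MARS_at_iff[OF m]
  proof (intro allI impI, rule ccontr)
    fix z assume root: "mars_poly m (of_real x) z = 0" and "\<not> norm z < 1"
    then have z: "norm z \<ge> 1" by simp
    \<comment> \<open>For |z| >= 1 every |z^k| with k < m is at most |z|^m, so the root equation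
      would give |z|^m <= x |z|^m with x < 1.\<close>
    have "norm (z ^ m) = norm (of_real x / of_nat m * (\<Sum>k<m. z ^ k))"
      using root by (simp add: mars_poly_def)
    also have "\<dots> \<le> x / real m * (\<Sum>k<m. norm z ^ m)"
      unfolding norm_mult using x z
      by (intro mult_mono sum_norm_le)
         (auto simp: norm_divide norm_power intro!: power_increasing sum_nonneg)
    also have "\<dots> = x * norm z ^ m" using m by simp
    also have "\<dots> < 1 * norm z ^ m" using x1 z by (intro mult_strict_right_mono zero_less_power) auto
    finally show False by (simp add: norm_power)
  qed
qed

text \<open>With c = -x/m in (0,1) a root satisfies |z|^m |z - (1-c)| = c. For |z| >= 1 the left
  side is at least c, with equality only at z = 1.\<close>

lemma MARS_at_neg:
  assumes m: "m \<ge> 1" and x: "- real m < x" "x < 0"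
  shows "complex_of_real x \<in> MARS_at m"
  unfolding MARS_at_iff[OF m]
proof (intro allI impI, rule ccontr)
  fix z assume root: "mars_poly m (of_real x) z = 0" and "\<not> norm z < 1"
  then have z: "norm z \<ge> 1" by simp
  define c where "c = - x / real m"
  have c: "0 < c" "c < 1" using x m by (auto simp: c_def field_simps)
  have "z ^ m * (z - of_real (1 - c)) = of_real c"
    using mars_poly_times[of z m "of_real x"] root by (simp add: c_def algebra_simps)
  from arg_cong[OF this, of norm] have eq: "norm z ^ m * norm (z - of_real (1 - c)) = c"
    using c by (simp add: norm_mult norm_power)
  have "norm z - norm (complex_of_real (1 - c)) \<le> norm (z - of_real (1 - c))"
    by (rule norm_triangle_ineq2)
  then have ge: "c + (norm z - 1) \<le> norm (z - of_real (1 - c))" using c by (simp del: of_real_diff)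
  have "1 * (c + (norm z - 1)) \<le> norm z ^ m * norm (z - of_real (1 - c))"
    using z c ge by (intro mult_mono one_le_power) auto
  with eq z have z1: "norm z = 1" by simp
  with eq have "(norm (z - of_real (1 - c)))\<^sup>2 = c\<^sup>2" by simp
  moreover have "(norm z)\<^sup>2 = 1" using z1 by simp
  ultimately have "(1 - c) * (1 - Re z) = 0"
    unfolding cmod_power2 by (simp add: algebra_simps power2_eq_square)
  then have "Re z = 1" using c by simp
  moreover have "Im z = 0" using z1 cmod_power2[of z] \<open>Re z = 1\<close> by simp
  ultimately have "z = 1" by (simp add: complex_eq_iff)
  \<comment> \<open>The candidate z = 1 stems from the factor z - 1 in
    \<open>mars_poly_times\<close>; the value of \<open>mars_poly\<close> there is 1 - x, which is
    nonzero.\<close>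
  with root m have "complex_of_real x = 1" by (simp add: mars_poly_def)
  then show False using x by simp
qed

lemma cnj_MARS_at_iff:
  assumes "m \<ge> 1"
  shows "cnj a \<in> MARS_at m \<longleftrightarrow> a \<in> MARS_at m"
proof -
  have "mars_poly m (cnj a) z = cnj (mars_poly m a (cnj z))" for a z
    by (simp add: mars_poly_def)
  then show ?thesis
    unfolding MARS_at_iff[OF assms] by (metis complex_cnj_cnj complex_cnj_zero_iff complex_mod_cnj)
qed

text \<open>The substitution w = 1/z moves the unbounded region |z| >= 1 into the compact disc. The
  added point w = 0 does no harm: all exponents m - k are positive, so the sum vanishes
  there.\<close>

lemma not_MARS_at_iff:
  assumes "m \<ge> 1"
  shows "a \<notin> MARS_at m \<longleftrightarrow> (\<exists>w\<in>cball 0 1. a * (\<Sum>k<m. w ^ (m - k)) = of_nat m)"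
proof
  assume "a \<notin> MARS_at m"
  then obtain z where z: "mars_poly m a z = 0" "norm z \<ge> 1"
    by (auto simp: MARS_at_iff[OF assms] not_less)
  then have "z \<noteq> 0" by auto
  then have "(\<Sum>k<m. (1 / z) ^ (m - k)) = (\<Sum>k<m. z ^ k) / z ^ m"
    by (simp add: sum_divide_distrib power_one_over power_diff)
  moreover have "a * (\<Sum>k<m. z ^ k) = of_nat m * z ^ m"
    using z(1) assms by (simp add: mars_poly_def field_simps)
  ultimately have "a * (\<Sum>k<m. (1 / z) ^ (m - k)) = of_nat m"
    using \<open>z \<noteq> 0\<close> by simp
  then show "\<exists>w\<in>cball 0 1. a * (\<Sum>k<m. w ^ (m - k)) = of_nat m"
    using z(2) by (intro bexI[of _ "1 / z"]) (auto simp: norm_divide divide_simps)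
next
  assume "\<exists>w\<in>cball 0 1. a * (\<Sum>k<m. w ^ (m - k)) = of_nat m"
  then obtain w where w: "norm w \<le> 1" "a * (\<Sum>k<m. w ^ (m - k)) = of_nat m" by auto
  have "w \<noteq> 0"
  proof
    assume "w = 0"
    then have "(\<Sum>k<m. w ^ (m - k)) = 0" by (intro sum.neutral) auto
    with w(2) assms show False by simp
  qed
  then have "(\<Sum>k<m. (1 / w) ^ k) = (\<Sum>k<m. w ^ (m - k)) / w ^ m"
    by (simp add: sum_divide_distrib power_one_over power_diff)
  then have "mars_poly m a (1 / w) = 1 / w ^ m - a * (\<Sum>k<m. w ^ (m - k)) / (of_nat m * w ^ m)"
    by (simp add: mars_poly_def power_one_over)
  then have "mars_poly m a (1 / w) = 0"
    using w(2) assms by simp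
  moreover have "norm (1 / w) \<ge> 1"
    using w(1) \<open>w \<noteq> 0\<close> by (simp add: norm_divide divide_simps)
  ultimately show "a \<notin> MARS_at m" by (auto simp: MARS_at_iff[OF assms] not_less)
qed

text \<open>The complement is the projection of a closed set of pairs along a compact disc, hence
  closed.\<close>

lemma open_MARS_at:
  assumes "m \<ge> 1"
  shows "open (MARS_at m)"
proof -
  have "closed {p. snd p * (\<Sum>k<m. fst p ^ (m - k)) = (of_nat m :: complex)}"
    by (intro closed_Collect_eq continuous_intros)
  from closed_compact_projection[OF compact_cball this, of 0 1]
  have "closed {a::complex. \<exists>w\<in>cball 0 1. a * (\<Sum>k<m. w ^ (m - k)) = of_nat m}"
    by (simp add: Bex_def)
  also have "{a::complex. \<exists>w\<in>cball 0 1. a * (\<Sum>k<m. w ^ (m - k)) = of_nat m} = - MARS_at m"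
    using not_MARS_at_iff[OF assms] by blast
  finally show ?thesis by (simp add: open_closed)
qed

section \<open>The region swept out by all parameters\<close>

text \<open>A rearrangement of exp(2iu) - 1 = 2i sin u exp(iu) = r (exp(i(u+v)) - exp(i(u-v))) with
  r = sin u / sin v; the last two terms have equal modulus.\<close>

lemma cis_double_minus:
  assumes "sin v \<noteq> 0"
  shows "cis (2 * u) - 1 - of_real (sin u / sin v) * cis (u + v) =
    - (of_real (sin u / sin v) * cis (u - v))"
proof (rule complex_eqI)
  show "Re (cis (2 * u) - 1 - of_real (sin u / sin v) * cis (u + v)) =
    Re (- (of_real (sin u / sin v) * cis (u - v)))"
    using assms
    by (simp add: cos_double_sin cos_add cos_diff) (simp add: field_simps power2_eq_square)
  show "Im (cis (2 * u) - 1 - of_real (sin u / sin v) * cis (u + v)) =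
    Im (- (of_real (sin u / sin v) * cis (u - v)))"
    using assms by (simp add: sin_double sin_add sin_diff) (simp add: field_simps)
qed

text \<open>Two angles parametrize the candidates so that the moduli agree automatically; if sin u
  is nonzero, cis (2u) is then a root exactly when m u - v is a multiple of pi.\<close>

lemma mars_poly_cis:
  assumes m: "m \<ge> 1" and v: "sin v \<noteq> 0"
  shows "(cis (2 * u) - 1) * mars_poly m (of_real (real m * (sin u / sin v)) * cis (u + v)) (cis (2 * u)) =
    of_real (sin u / sin v) * (cis (u + v) - cis (real m * (2 * u) + (u - v)))"
proof -
  have "of_real (real m * (sin u / sin v)) * cis (u + v) / of_nat m = of_real (sin u / sin v) * cis (u + v)"
    using m by simp
  then have "(cis (2 * u) - 1) * mars_poly m (of_real (real m * (sin u / sin v)) * cis (u + v)) (cis (2 * u)) =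
      of_real (sin u / sin v) * (cis (u + v) - cis (2 * u) ^ m * cis (u - v))"
    unfolding mars_poly_times by (simp only: cis_double_minus[OF v]) (simp add: algebra_simps)
  then show ?thesis by (simp only: Complex.DeMoivre cis_mult)
qed

text \<open>The angles u = \<psi> / (m+1) and v = \<psi> - u solve m u = v and u + v = \<psi>; this
  is the modulus of the corresponding parameter in \<open>mars_poly_cis\<close>.\<close>

definition mars_radius :: "nat \<Rightarrow> real \<Rightarrow> real" where
  "mars_radius m \<psi> = real m * (sin (\<psi> / (real m + 1)) / sin (\<psi> - \<psi> / (real m + 1)))"

lemma mars_radius_angles:
  assumes "m \<ge> 1" "0 < \<psi>" "\<psi> < pi"
  defines "t \<equiv> \<psi> / (real m + 1)"
  shows "0 < t" "t < pi / 2" "0 < \<psi> - t" "\<psi> - t < pi" "(real m + 1) * t = \<psi>"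
proof -
  show t: "0 < t" "(real m + 1) * t = \<psi>" using assms by (simp_all add: t_def)
  have "2 * t \<le> (real m + 1) * t" using t assms(1) by (intro mult_right_mono) auto
  with t assms(2,3) show "t < pi / 2" "0 < \<psi> - t" "\<psi> - t < pi" by auto
qed

lemma mars_radius_pos:
  assumes "m \<ge> 1" "0 < \<psi>" "\<psi> < pi"
  shows "0 < mars_radius m \<psi>"
  using mars_radius_angles[OF assms] assms
  unfolding mars_radius_def by (intro mult_pos_pos divide_pos_pos sin_gt_zero) auto

lemma mars_poly_radius_root:
  assumes "m \<ge> 1" "0 < \<psi>" "\<psi> < pi"
  shows "mars_poly m (of_real (mars_radius m \<psi>) * cis \<psi>) (cis (2 * (\<psi> / (real m + 1)))) = 0"
proof -
  define t where "t = \<psi> / (real m + 1)"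
  note t = mars_radius_angles[OF assms, folded t_def]
  have "sin (\<psi> - t) \<noteq> 0" using sin_gt_zero[OF t(3,4)] by simp
  moreover have eq: "real m * (2 * t) + (t - (\<psi> - t)) = \<psi>" "t + (\<psi> - t) = \<psi>"
    using t(5) by (simp_all add: algebra_simps)
  ultimately have "(cis (2 * t) - 1) * mars_poly m (of_real (mars_radius m \<psi>) * cis \<psi>) (cis (2 * t)) = 0"
    using mars_poly_cis[OF assms(1), of "\<psi> - t" t, unfolded eq]
    by (simp add: mars_radius_def flip: t_def)
  moreover have "sin (2 * t) \<noteq> 0" using sin_gt_zero[of "2 * t"] t by simp
  then have "cis (2 * t) \<noteq> 1" by (auto simp: complex_eq_iff)
  ultimately show ?thesis by (simp add: t_def)
qed

text \<open>A unimodular root cis (2u) fixes the modulus of \<open>a\<close> as m sin u / sin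
  (\<psi> - u), which increases with u, and the argument condition m u - v = k pi admits no u below
  \<psi> / (m+1).\<close>

lemma mars_radius_le_norm:
  assumes m: "m \<ge> 1" and a: "Im a > 0" and z: "norm z = 1" and root: "mars_poly m a z = 0"
  shows "mars_radius m (Arg a) \<le> norm a"
proof -
  define \<psi> where "\<psi> = Arg a"
  define \<rho> where "\<rho> = norm a / real m"
  define u where "u = Arg2pi z / 2"
  define v where "v = \<psi> - u"
  define t where "t = \<psi> / (real m + 1)"
  have \<psi>: "0 < \<psi>" "\<psi> < pi" using Arg_lt_pi[of a] a by (auto simp: \<psi>_def)
  note t = mars_radius_angles[OF m \<psi>, folded t_def]
  have "a \<noteq> 0" using a by auto
  then have \<rho>: "\<rho> > 0" using m by (simp add: \<rho>_def)
  have a_eq: "a = of_real (norm a) * cis \<psi>"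
    unfolding \<psi>_def cis_conv_exp using \<open>a \<noteq> 0\<close> by (simp add: Arg_eq)
  then have c_eq: "a / of_nat m = of_real \<rho> * cis \<psi>"
    by (simp add: \<rho>_def)
  have z_eq: "z = cis (2 * u)"
    using Arg2pi_eq[of z] z by (simp add: u_def cis_conv_exp)
  have "z \<noteq> 1"
  proof
    assume "z = 1"
    with root m have "a = 1" by (simp add: mars_poly_def)
    with a show False by simp
  qed
  then have "u \<noteq> 0" using z_eq by auto
  then have u: "0 < u" "u < pi"
    using Arg2pi_ge_0[of z] Arg2pi_lt_2pi[of z] by (auto simp: u_def)
  have sin_u: "sin u > 0" using u by (intro sin_gt_zero) auto
  have "z ^ m * (z - 1 - of_real \<rho> * cis \<psi>) = - (of_real \<rho> * cis \<psi>)"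
    using mars_poly_times[of z m a] root by (simp add: c_eq eq_neg_iff_add_eq_0)
  \<comment> \<open>Taking moduli removes z^m; in terms of u the remaining equation reads sin u =
    \<rho> sin v.\<close>
  from arg_cong[OF this, of "\<lambda>x. (norm x)\<^sup>2"] z
  have "(norm (z - 1 - of_real \<rho> * cis \<psi>))\<^sup>2 = (norm (of_real \<rho> * cis \<psi>))\<^sup>2"
    by (simp add: norm_mult norm_power)
  then have "(cos (2 * u) - 1)\<^sup>2 + (sin (2 * u))\<^sup>2 =
      2 * \<rho> * ((cos (2 * u) - 1) * cos \<psi> + sin (2 * u) * sin \<psi>)"
    unfolding cmod_power2 z_eq
    by (simp add: algebra_simps power2_eq_square )
  also have "(cos (2 * u) - 1)\<^sup>2 + (sin (2 * u))\<^sup>2 = 2 - 2 * cos (2 * u)"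
    using sin_cos_squared_add[of "2 * u"] by (simp add: power2_eq_square algebra_simps)
  also have "2 - 2 * cos (2 * u) = 4 * sin u * sin u"
    by (simp add: cos_double_sin power2_eq_square)
  also have "2 * \<rho> * ((cos (2 * u) - 1) * cos \<psi> + sin (2 * u) * sin \<psi>) = 4 * sin u * (\<rho> * sin v)"
    unfolding cos_double_sin sin_double v_def sin_diff by (simp add: power2_eq_square algebra_simps)
  finally have sin_uv: "sin u = \<rho> * sin v" using sin_u by simp
  with sin_u \<rho> have sin_v: "sin v > 0" by (simp add: zero_less_mult_iff)
  \<comment> \<open>v lies in (-pi, pi), where a positive sine excludes v <= 0.\<close>
  have "v > 0"
  proof (rule ccontr)
    assume "\<not> v > 0"
    then have "0 \<le> sin (- v)" using u \<psi> by (intro sin_ge_zero) (auto simp: v_def)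
    with sin_v show False by simp
  qed
  have \<rho>_eq: "\<rho> = sin u / sin v" using sin_uv sin_v by simp
  have "of_real (real m * (sin u / sin v)) * cis (u + v) = a"
    unfolding \<rho>_eq[symmetric] using c_eq m by (simp add: v_def field_simps)
  then have "of_real \<rho> * (cis (u + v) - cis (real m * (2 * u) + (u - v))) = 0"
    using mars_poly_cis[OF m, of v u] sin_v root by (simp add: z_eq \<rho>_eq)
  then have "cis (u + v) = cis (real m * (2 * u) + (u - v))" using \<rho> by simp
  also have "\<dots> = cis (u + v) * cis (2 * (real m * u - v))"
    by (simp add: cis_mult algebra_simps)
  finally have "cis (2 * (real m * u - v)) = 1"
    using cis_neq_zero[of "u + v"] by simp
  then have "exp (\<i> * of_real (2 * (real m * u - v))) = 1" by (simp only: cis_conv_exp)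
  then obtain k :: int where "2 * (real m * u - v) = of_int (2 * k) * pi"
    by (auto simp: exp_eq_1)
  then have k: "real m * u - v = of_int k * pi" by simp
  have "0 \<le> real m * u" using u by simp
  \<comment> \<open>The strict bound leaves no negative k, and m u >= v = \<psi> - u means u >=
    t.\<close>
  then have "real m * u - v > - pi" using u \<psi> unfolding v_def by linarith
  then have "of_int k * pi > of_int (-1) * pi" using k by simp
  then have "k \<ge> 0" by (simp del: of_int_minus)
  then have "real m * u - v \<ge> 0" using k by simp
  then have "(real m + 1) * t \<le> (real m + 1) * u" unfolding t by (simp add: v_def algebra_simps)
  then have tu: "t \<le> u" by (simp add: mult_le_cancel_left)
  \<comment> \<open>This is the monotonicity of u |-> sin u / sin (\<psi> - u), cleared of
    denominators; the last factor equals 1.\<close>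
  have "sin u * sin (\<psi> - t) - sin t * sin v = sin (u - t) * sin \<psi> * ((sin u)\<^sup>2 + (cos u)\<^sup>2)"
    unfolding v_def sin_diff by (simp add: algebra_simps power2_eq_square)
  moreover have "0 \<le> sin (u - t) * sin \<psi>"
    using tu u t \<psi> by (intro mult_nonneg_nonneg sin_ge_zero) auto
  ultimately have "sin t * sin v \<le> sin u * sin (\<psi> - t)" by simp
  then have "sin t / sin (\<psi> - t) \<le> \<rho>"
    unfolding \<rho>_eq using sin_v sin_gt_zero[OF t(3,4)] by (simp add: divide_simps mult.commute)
  then have "real m * (sin t / sin (\<psi> - t)) \<le> real m * \<rho>"
    by (intro mult_left_mono) auto
  then show ?thesis using m by (simp add: mars_radius_def \<rho>_def t_def \<psi>_def)
qed

text \<open>Concavity gives sin (m \<psi> / (m+1)) >= m / (m+1) * sin \<psi> for the denominator,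
  and the numerator is bounded by sin t <= t.\<close>

lemma mars_radius_le:
  assumes m: "m \<ge> 1" and \<psi>: "0 < \<psi>" "\<psi> < pi"
  shows "mars_radius m \<psi> \<le> \<psi> / sin \<psi>"
proof -
  define t where "t = \<psi> / (real m + 1)"
  note t = mars_radius_angles[OF m \<psi>, folded t_def]
  have "concave_on {0..pi} sin"
    unfolding concave_on_def
  proof (rule f''_ge0_imp_convex)
    show "((\<lambda>x. - sin x) has_real_derivative - cos x) (at x)" for x
      by (auto intro!: derivative_eq_intros)
    show "((\<lambda>x. - cos x) has_real_derivative sin x) (at x)" for x
      by (auto intro!: derivative_eq_intros)
  qed (auto intro: sin_ge_zero)
  from concave_onD[OF this, of "real m / (real m + 1)" 0 \<psi>]
  have "real m / (real m + 1) * sin \<psi> \<le> sin (real m / (real m + 1) * \<psi>)"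
    using \<psi> by (simp add: divide_simps)
  also have "real m / (real m + 1) * \<psi> = \<psi> - t"
    by (simp add: t_def field_simps)
  finally have "real m * sin \<psi> \<le> (real m + 1) * sin (\<psi> - t)"
    by (simp add: divide_simps mult.commute)
  then have "t * (real m * sin \<psi>) \<le> t * ((real m + 1) * sin (\<psi> - t))"
    using t by (intro mult_left_mono) auto
  also have "\<dots> = \<psi> * sin (\<psi> - t)" using t(5) by (simp add: mult.commute mult.left_commute)
  finally have "real m * (t * sin \<psi>) \<le> \<psi> * sin (\<psi> - t)" by (simp add: mult.left_commute)
  moreover have "real m * (sin t * sin \<psi>) \<le> real m * (t * sin \<psi>)"
    using t \<psi> sin_x_le_x[of t] sin_gt_zero[of \<psi>] by (intro mult_left_mono mult_right_mono) auto
  ultimately have "real m * (sin t * sin \<psi>) \<le> \<psi> * sin (\<psi> - t)" by linarith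
  then show ?thesis
    using sin_gt_zero[OF t(3,4)] sin_gt_zero[OF \<psi>]
    by (simp add: mars_radius_def t_def[symmetric] divide_simps mult_ac)
qed

lemma mars_radius_tendsto:
  assumes "0 < \<psi>" "\<psi> < pi"
  shows "(\<lambda>m. mars_radius m \<psi>) \<longlonglongrightarrow> \<psi> / sin \<psi>"
proof -
  have "(\<lambda>m. real m * sin (\<psi> / (real m + 1))) \<longlonglongrightarrow> \<psi>"
    using assms by real_asymp
  moreover have "(\<lambda>m. \<psi> - \<psi> / (real m + 1)) \<longlonglongrightarrow> \<psi>"
    using assms by real_asymp
  then have "(\<lambda>m. sin (\<psi> - \<psi> / (real m + 1))) \<longlonglongrightarrow> sin \<psi>"
    by (rule tendsto_sin)
  ultimately have "(\<lambda>m. real m * sin (\<psi> / (real m + 1)) / sin (\<psi> - \<psi> / (real m + 1))) \<longlonglongrightarrow> \<psi> / sin \<psi>"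
    using sin_gt_zero[OF assms] by (intro tendsto_divide) auto
  then show ?thesis by (simp add: mars_radius_def)
qed

text \<open>Since Im a = |a| sin \<psi>, the condition says |a| < \<psi> / sin \<psi>. From this
  value on, \<open>a\<close> lies at or past a parameter with a unimodular root for every m. Below
  it, a large m has \<open>mars_radius m \<psi>\<close> above |a|, and the segment from 0 to
  \<open>a\<close> meets no parameter with a unimodular root.\<close>

lemma MARS_upper_half_iff:
  assumes a: "Im a > 0"
  shows "a \<in> MARS \<longleftrightarrow> Im a < Arg a"
proof -
  define \<psi> where "\<psi> = Arg a"
  have \<psi>: "0 < \<psi>" "\<psi> < pi" using Arg_lt_pi[of a] a by (auto simp: \<psi>_def)
  have "a \<noteq> 0" using a by auto
  then have a_eq: "a = of_real (norm a) * cis \<psi>"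
    unfolding \<psi>_def cis_conv_exp by (simp add: Arg_eq)
  have Im: "Im a = norm a * sin \<psi>" by (subst a_eq) simp
  have sin: "sin \<psi> > 0" using sin_gt_zero[OF \<psi>] .
  have "a \<in> MARS \<longleftrightarrow> Im a < \<psi>"
  proof
    assume "a \<in> MARS"
    then obtain m where m: "m \<ge> 1" "a \<in> MARS_at m" by (auto simp: MARS_def)
    show "Im a < \<psi>"
    proof (rule ccontr)
      assume "\<not> Im a < \<psi>"
      then have "\<psi> / sin \<psi> \<le> norm a" using sin by (simp add: Im divide_simps)
      with mars_radius_le[OF m(1) \<psi>] have "mars_radius m \<psi> \<le> norm a" by simp
      then have "norm a / mars_radius m \<psi> \<ge> 1"
        using mars_radius_pos[OF m(1) \<psi>] by simp
      from not_MARS_at_beyond_unit_root[OF m(1) _ mars_poly_radius_root[OF m(1) \<psi>] this]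
      have "of_real (norm a) * cis \<psi> \<notin> MARS_at m"
        using mars_radius_pos[OF m(1) \<psi>] by simp
      with m(2) a_eq show False by simp
    qed
  next
    assume "Im a < \<psi>"
    then have "norm a < \<psi> / sin \<psi>" using sin by (simp add: Im less_divide_eq)
    then have "\<forall>\<^sub>F m in sequentially. norm a < mars_radius m \<psi>"
      using mars_radius_tendsto[OF \<psi>] by (rule order_tendstoD(1)[rotated])
    then have "\<forall>\<^sub>F m in sequentially. norm a < mars_radius m \<psi> \<and> m \<ge> 1"
      by (intro eventually_conj eventually_ge_at_top)
    then obtain m where m: "norm a < mars_radius m \<psi>" "m \<ge> 1"
      by (auto dest: eventually_happens)
    have "a \<in> MARS_at m"
    proof (rule ccontr)
      assume "a \<notin> MARS_at m"
      moreover have zero: "0 \<in> MARS_at m" using MARS_at_nonneg_iff[OF m(2), of 0] by simp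
      \<comment> \<open>Leaving the open set along the segment produces a frontier parameter; its
        roots have modulus at most 1, and one has modulus at least 1.\<close>
      ultimately have "closed_segment 0 a \<inter> frontier (MARS_at m) \<noteq> {}"
        by (intro connected_Int_frontier) auto
      then obtain t where t: "0 \<le> t" "t \<le> 1" "of_real t * a \<in> frontier (MARS_at m)"
        by (auto simp: in_segment scaleR_conv_of_real)
      then have b: "of_real t * a \<in> closure (MARS_at m)" "of_real t * a \<notin> MARS_at m"
        using open_MARS_at[OF m(2)] by (auto simp: frontier_def interior_open)
      with zero have "t > 0" using t(1) by (cases "t = 0") auto
      from b(2) obtain z where z: "mars_poly m (of_real t * a) z = 0" "norm z \<ge> 1"
        by (auto simp: MARS_at_iff[OF m(2)] not_less)
      with closure_MARS_at_root_norm_le[OF m(2) b(1)] have "norm z = 1" by force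
      with z(1) have "mars_radius m (Arg (of_real t * a)) \<le> norm (of_real t * a)"
        using \<open>t > 0\<close> a by (intro mars_radius_le_norm[OF m(2)]) auto
      also have "norm (of_real t * a) \<le> norm a"
        using t by (simp add: norm_mult mult_left_le_one_le)
      finally show False using m(1) \<open>t > 0\<close> by (simp add: Arg_times_of_real \<psi>_def)
    qed
    with m(2) show "a \<in> MARS" by (auto simp: MARS_def)
  qed
  then show ?thesis by (simp add: \<psi>_def)
qed

section \<open>The real axis and a description of \<open>MARS\<close> in Cartesian
  coordinates\<close>

lemma of_real_in_MARS_iff: "complex_of_real x \<in> MARS \<longleftrightarrow> x < 1"
proof (cases "x \<ge> 0")
  case True
  then show ?thesis
    using MARS_at_nonneg_iff[OF _ True] by (auto simp: MARS_def intro: bexI[of _ 1])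
next
  case False
  obtain m where "- x < real m" using reals_Archimedean2 by blast
  with False have "m \<ge> 1" "complex_of_real x \<in> MARS_at m"
    by (cases m; force intro!: MARS_at_neg)+
  with False show ?thesis by (auto simp: MARS_def)
qed

text \<open>The expression equals |a| sin (Arg a - Im a), which replaces \<open>Arg\<close> by
  functions analytic on the whole plane. The bound Im a < pi keeps Arg a - Im a in (-pi, pi), where
  the sine has the sign of its argument.\<close>

lemma MARS_upper_half_iff_Cartesian:
  assumes a: "Im a > 0"
  shows "a \<in> MARS \<longleftrightarrow> Im a < pi \<and> 0 < Im a * cos (Im a) - Re a * sin (Im a)"
proof -
  define \<psi> where "\<psi> = Arg a"
  have \<psi>: "0 < \<psi>" "\<psi> < pi" using Arg_lt_pi[of a] a by (auto simp: \<psi>_def)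
  have "a \<noteq> 0" using a by auto
  then have a_eq: "a = of_real (norm a) * cis \<psi>"
    unfolding \<psi>_def cis_conv_exp by (simp add: Arg_eq)
  have "Im a * cos (Im a) - Re a * sin (Im a) = norm a * sin (\<psi> - Im a)"
    using arg_cong[OF a_eq, of Re] arg_cong[OF a_eq, of Im] by (simp add: sin_diff algebra_simps)
  then have "0 < Im a * cos (Im a) - Re a * sin (Im a) \<longleftrightarrow> 0 < sin (\<psi> - Im a)"
    using \<open>a \<noteq> 0\<close> by (simp add: zero_less_mult_iff)
  moreover have "0 < sin (\<psi> - Im a) \<longleftrightarrow> Im a < \<psi>" if "Im a < pi"
  proof
    assume "Im a < \<psi>"
    then show "0 < sin (\<psi> - Im a)" using \<psi> a by (intro sin_gt_zero) auto
  next
    assume "0 < sin (\<psi> - Im a)"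
    moreover have "0 \<le> sin (Im a - \<psi>)" if "Im a \<ge> \<psi>"
      using that \<psi> \<open>Im a < pi\<close> by (intro sin_ge_zero) auto
    moreover have "sin (\<psi> - Im a) = - sin (Im a - \<psi>)"
      by (metis minus_diff_eq sin_minus)
    ultimately show "Im a < \<psi>" by force
  qed
  ultimately show ?thesis
    using MARS_upper_half_iff[OF a] \<psi> by (auto simp: \<psi>_def)
qed

text \<open>Conjugation exchanges the half-planes and changes the sign of \<open>d\<close>. On the
  real axis \<open>d\<close> vanishes, so that case stands apart.\<close>

lemma MARS_iff_Cartesian:
  defines "d \<equiv> \<lambda>a. Im a * cos (Im a) - Re a * sin (Im a)"
  shows "a \<in> MARS \<longleftrightarrow> Im a = 0 \<and> Re a < 1 \<or> 0 < Im a \<and> Im a < pi \<and> 0 < d a \<or>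
    Im a < 0 \<and> - pi < Im a \<and> d a < 0"
proof -
  consider "Im a = 0" | "Im a > 0" | "Im a < 0" by linarith
  then show ?thesis
  proof cases
    case 1
    then have "a = of_real (Re a)" by (simp add: complex_eq_iff)
    then show ?thesis using of_real_in_MARS_iff[of "Re a"] 1 by simp
  next
    case 2
    then show ?thesis using MARS_upper_half_iff_Cartesian[OF 2] by (simp add: d_def)
  next
    case 3
    have "a \<in> MARS \<longleftrightarrow> cnj a \<in> MARS" by (auto simp: MARS_def cnj_MARS_at_iff)
    also have "\<dots> \<longleftrightarrow> - Im a < pi \<and> d a < 0"
      using MARS_upper_half_iff_Cartesian[of "cnj a"] 3 by (simp add: d_def)
    finally show ?thesis using 3 by auto
  qed
qed

section \<open>Semialgebraicity by the Schur--Cohn recursion\<close>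

lemma reflected_coeffs_sum:
  fixes c :: "nat \<Rightarrow> complex"
  assumes "z \<noteq> 0"
  shows "(\<Sum>k\<le>n. cnj (c (n - k)) * z ^ k) = z ^ n * cnj (\<Sum>k\<le>n. c k * (1 / cnj z) ^ k)"
proof -
  have "(\<Sum>k\<le>n. cnj (c (n - k)) * z ^ k) = (\<Sum>k\<le>n. cnj (c k) * z ^ (n - k))"
    by (rule sum.reindex_bij_witness[of _ "\<lambda>k. n - k" "\<lambda>k. n - k"]) auto
  also have "\<dots> = z ^ n * (\<Sum>k\<le>n. cnj (c k) * (1 / z) ^ k)"
    unfolding sum_distrib_left using assms
    by (intro sum.cong refl) (simp add: power_diff power_one_over)
  finally show ?thesis by (simp add: cnj_sum)
qed

lemma sum_coeffs_poly:
  fixes c :: "nat \<Rightarrow> complex"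
  assumes "c n \<noteq> 0"
  obtains p where "degree p = n" "lead_coeff p = c n" "\<And>z. poly p z = (\<Sum>k\<le>n. c k * z ^ k)"
proof
  let ?p = "\<Sum>k\<le>n. Polynomial.monom (c k) k"
  have coeff: "coeff ?p j = (if j \<le> n then c j else 0)" for j
    by (simp add: Polynomial.coeff_sum)
  show deg: "degree ?p = n"
    using assms by (intro antisym degree_le le_degree) (auto simp: coeff)
  show "lead_coeff ?p = c n" unfolding deg by (simp add: coeff)
  show "poly ?p z = (\<Sum>k\<le>n. c k * z ^ k)" for z
    by (simp add: poly_sum poly_monom)
qed

text \<open>Phrased for coefficient sequences with a nominal degree, so that the coefficients can
  depend on a parameter.\<close>

definition roots_in_unit_disc :: "nat \<Rightarrow> (nat \<Rightarrow> complex) \<Rightarrow> bool" where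
  "roots_in_unit_disc n c \<longleftrightarrow> (\<forall>z. (\<Sum>k\<le>n. c k * z ^ k) = 0 \<longrightarrow> norm z < 1)"

lemma roots_in_unit_disc_reflected_le:
  assumes c: "c n \<noteq> 0" "roots_in_unit_disc n c" and z: "norm z \<ge> 1"
  shows "norm (z ^ n * (\<Sum>k\<le>n. c k * (1 / cnj z) ^ k)) \<le> norm (\<Sum>k\<le>n. c k * z ^ k)"
proof -
  obtain p where p: "degree p = n" "\<And>z. poly p z = (\<Sum>k\<le>n. c k * z ^ k)"
    using sum_coeffs_poly[of c n] c(1) by blast
  show ?thesis
    using poly_norm_reflected_le[of p z] c(2) z unfolding p roots_in_unit_disc_def by blast
qed

text \<open>c 0 / c n is, up to sign, the product of the n > 0 roots.\<close>

lemma roots_in_unit_disc_norm_less: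
  assumes c: "c n \<noteq> 0" "roots_in_unit_disc n c" and n: "n > 0"
  shows "norm (c 0) < norm (c n)"
proof -
  obtain p where p: "degree p = n" "lead_coeff p = c n" "\<And>z. poly p z = (\<Sum>k\<le>n. c k * z ^ k)"
    using sum_coeffs_poly[of c n] c(1) by blast
  have "p \<noteq> 0" using p(1) n by auto
  then obtain A where A: "size A = degree p" "\<And>z. poly p z = lead_coeff p * (\<Prod>x\<in>#A. z - x)"
    using complex_poly_factorization by blast
  have norm: "norm x < 1" if "x \<in># A" for x
  proof -
    have "poly p x = 0" using that by (simp add: A(2))
    then show ?thesis using c(2) by (simp add: p(3) roots_in_unit_disc_def)
  qed
  have "A \<noteq> {#}" using A(1) p(1) n by auto
  then have "norm (\<Prod>x\<in>#A. 0 - x) < 1"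
    using norm
  proof (induction A)
    case (add x A)
    show ?case
    proof (cases "A = {#}")
      case True
      then show ?thesis using add.prems(2)[of x] by simp
    next
      case False
      then have "norm (\<Prod>x\<in>#A. 0 - x) < 1" using add.IH add.prems by simp
      moreover have "norm x < 1" using add.prems by simp
      ultimately have "norm x * norm (\<Prod>x\<in>#A. 0 - x) < 1 * 1"
        by (intro mult_strict_mono') auto
      then show ?thesis by (simp add: norm_mult)
    qed
  qed simp
  moreover have "c 0 = c n * (\<Prod>x\<in>#A. 0 - x)"
    using A(2)[of 0] p(3)[of 0] unfolding p(2) by (simp add: power_0_left if_distrib cong: if_cong)
  ultimately show ?thesis using c(1) by (simp add: norm_mult)
qed

text \<open>
  With \<open>P\<close> the polynomial of degree \<open>n\<close> with coefficients \<open>c\<close> and \<open>P\<^sup>*(z) = z\<^sup>n cnj (P (1 / cnj z))\<close>,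
  these are the coefficients of \<open>(cnj (c n) P - c 0 P\<^sup>*) / z\<close>.
\<close>

definition schur_reduct :: "nat \<Rightarrow> (nat \<Rightarrow> complex) \<Rightarrow> nat \<Rightarrow> complex" where
  "schur_reduct n c k = cnj (c n) * c (Suc k) - c 0 * cnj (c (n - Suc k))"

text \<open>The constant terms on the right cancel, so the division by z is exact.\<close>

lemma schur_reduct_sum:
  "z * (\<Sum>k\<le>n. schur_reduct (Suc n) c k * z ^ k) =
    cnj (c (Suc n)) * (\<Sum>k\<le>Suc n. c k * z ^ k) - c 0 * (\<Sum>k\<le>Suc n. cnj (c (Suc n - k)) * z ^ k)"
  unfolding sum.atMost_Suc_shift
  by (simp add: schur_reduct_def sum_distrib_left sum_subtractf algebra_simps del: sum.atMost_Suc)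

text \<open>One Schur--Cohn step, by comparing P with its reflection R. If S(z) = 0 with |z| >= 1,
  then |c_(n+1) P(z)| = |c_0 R(z)|, against |R(z)| <= |P(z)| and |c_0| < |c_(n+1)|. Conversely, a
  root z of P with |z| >= 1 relates S(z) to S at the reflected point 1 / cnj z, and the same
  comparison is applied to S.\<close>

lemma roots_in_unit_disc_Suc_iff:
  assumes c: "c (Suc n) \<noteq> 0"
  shows "roots_in_unit_disc (Suc n) c \<longleftrightarrow>
    norm (c 0) < norm (c (Suc n)) \<and> roots_in_unit_disc n (schur_reduct (Suc n) c)"
proof -
  define P where "P z = (\<Sum>k\<le>Suc n. c k * z ^ k)" for z
  define R where "R z = (\<Sum>k\<le>Suc n. cnj (c (Suc n - k)) * z ^ k)" for z
  define S where "S z = (\<Sum>k\<le>n. schur_reduct (Suc n) c k * z ^ k)" for z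
  have R: "R z = z ^ Suc n * cnj (P (1 / cnj z))" if "z \<noteq> 0" for z
    unfolding R_def P_def by (rule reflected_coeffs_sum[OF that])
  have S: "z * S z = cnj (c (Suc n)) * P z - c 0 * R z" for z
    unfolding S_def P_def R_def by (rule schur_reduct_sum)
  show ?thesis
  proof
    assume disc: "roots_in_unit_disc (Suc n) c"
    have less: "norm (c 0) < norm (c (Suc n))"
      by (rule roots_in_unit_disc_norm_less[OF c disc]) simp
    moreover have "roots_in_unit_disc n (schur_reduct (Suc n) c)"
      unfolding roots_in_unit_disc_def S_def[symmetric]
    proof (intro allI impI, rule ccontr)
      fix z assume "S z = 0" "\<not> norm z < 1"
      then have z: "norm z \<ge> 1" "z \<noteq> 0" by auto
      have "norm (R z) \<le> norm (P z)"
        using roots_in_unit_disc_reflected_le[OF c disc z(1)]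
        by (simp only: R[OF z(2)] norm_mult complex_mod_cnj P_def)
      then have "norm (c 0) * norm (R z) \<le> norm (c 0) * norm (P z)"
        by (intro mult_left_mono) auto
      moreover have "P z \<noteq> 0"
        using disc z(1) by (auto simp: roots_in_unit_disc_def P_def simp del: sum.atMost_Suc)
      then have "norm (c 0) * norm (P z) < norm (c (Suc n)) * norm (P z)"
        using less by simp
      moreover have "cnj (c (Suc n)) * P z = c 0 * R z"
        using S[of z] \<open>S z = 0\<close> by simp
      from arg_cong[OF this, of norm] have "norm (c (Suc n)) * norm (P z) = norm (c 0) * norm (R z)"
        by (simp add: norm_mult)
      ultimately show False by simp
    qed
    ultimately show "norm (c 0) < norm (c (Suc n)) \<and> roots_in_unit_disc n (schur_reduct (Suc n) c)" ..
  next
    assume *: "norm (c 0) < norm (c (Suc n)) \<and> roots_in_unit_disc n (schur_reduct (Suc n) c)"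
    \<comment> \<open>The reduct has leading coefficient |c_(n+1)|^2 - |c_0|^2 > 0, hence exact
      degree n, as the comparison with its reflection requires.\<close>
    have "schur_reduct (Suc n) c n = of_real ((norm (c (Suc n)))\<^sup>2 - (norm (c 0))\<^sup>2)"
      unfolding of_real_diff complex_norm_square by (simp add: schur_reduct_def mult.commute)
    moreover have "(norm (c 0))\<^sup>2 < (norm (c (Suc n)))\<^sup>2"
      using * by (intro power_strict_mono) auto
    ultimately have lead: "schur_reduct (Suc n) c n \<noteq> 0" by (metis less_irrefl of_real_eq_0_iff right_minus_eq)
    show "roots_in_unit_disc (Suc n) c"
      unfolding roots_in_unit_disc_def P_def[symmetric]
    proof (intro allI impI, rule ccontr)
      fix z assume root: "P z = 0" and "\<not> norm z < 1"
      then have z: "norm z \<ge> 1" "z \<noteq> 0" by auto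
      define w where "w = 1 / cnj z"
      have w: "w \<noteq> 0" "1 / cnj w = z" "cnj w * z = 1" using z(2) by (auto simp: w_def)
      have "c (Suc n) * (z * S z) = - (c 0 * (c (Suc n) * R z))"
        using S[of z] root by simp
      \<comment> \<open>P(z) = 0 makes R vanish at w, so cnj (c_(n+1)) P(w) is w S(w).\<close>
      also have "c (Suc n) * R z = z ^ Suc n * cnj (w * S w)"
        unfolding S R[OF z(2)] R[OF w(1)] w(2) root w_def[symmetric] by simp
      also have "\<dots> = z ^ n * cnj (S w)"
        using w(3) by (simp add: mult_ac)
      finally have "norm (c (Suc n)) * (norm z * norm (S z)) = norm (c 0) * norm (z ^ n * S w)"
        by (metis complex_mod_cnj norm_minus_cancel norm_mult)
      also have "\<dots> \<le> norm (c 0) * norm (S z)"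
        using roots_in_unit_disc_reflected_le[OF lead conjunct2[OF *] z(1)]
        by (intro mult_left_mono) (simp_all add: S_def w_def)
      also have "\<dots> < norm (c (Suc n)) * norm (S z)"
        using * z(1) by (intro mult_strict_right_mono) (auto simp: roots_in_unit_disc_def S_def)
      also have "\<dots> \<le> norm (c (Suc n)) * (norm z * norm (S z))"
        using z(1) by (intro mult_left_mono) (auto simp: mult_le_cancel_right1)
      finally show False by simp
    qed
  qed
qed

text \<open>Unrolls the Schur--Cohn recursion uniformly in x: the coefficients of the reduct remain
  polynomial in x, and each step adds one inequality.\<close>

lemma roots_in_unit_disc_polynomial_inequalities:
  fixes c :: "'a::real_normed_vector \<Rightarrow> nat \<Rightarrow> complex"
  assumes "\<And>k. real_polynomial_function (\<lambda>x. Re (c x k))"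
    and "\<And>k. real_polynomial_function (\<lambda>x. Im (c x k))"
  shows "\<exists>G. finite G \<and> G \<subseteq> {f. real_polynomial_function f} \<and>
    (\<forall>x. c x n \<noteq> 0 \<longrightarrow> (roots_in_unit_disc n (c x) \<longleftrightarrow> (\<forall>g\<in>G. g x > 0)))"
  using assms
proof (induction n arbitrary: c)
  case 0
  show ?case by (rule exI[of _ "{}"]) (auto simp: roots_in_unit_disc_def)
next
  case (Suc n)
  define d where "d x = schur_reduct (Suc n) (c x)" for x
  have "\<And>k. real_polynomial_function (\<lambda>x. Re (d x k))"
    and "\<And>k. real_polynomial_function (\<lambda>x. Im (d x k))"
    unfolding d_def schur_reduct_def
    by (simp_all, (intro real_polynomial_function_diff real_polynomial_function.intros(3)
          real_polynomial_function.intros(4) real_polynomial_function_minus Suc.prems)+)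
  from Suc.IH[of d, OF this] obtain G where G: "finite G" "G \<subseteq> {f. real_polynomial_function f}"
    "\<And>x. d x n \<noteq> 0 \<Longrightarrow> roots_in_unit_disc n (d x) \<longleftrightarrow> (\<forall>g\<in>G. g x > 0)"
    by blast
  define g where "g x = (Re (c x (Suc n)))\<^sup>2 + (Im (c x (Suc n)))\<^sup>2 - ((Re (c x 0))\<^sup>2 + (Im (c x 0))\<^sup>2)" for x
  have g_norm: "g x = (norm (c x (Suc n)))\<^sup>2 - (norm (c x 0))\<^sup>2" for x
    by (simp add: g_def cmod_power2)
  have g: "0 < g x \<longleftrightarrow> norm (c x 0) < norm (c x (Suc n))" for x
    unfolding g_norm using power2_less_imp_less power_strict_mono[of "norm (c x 0)" _ 2] by force
  have "roots_in_unit_disc (Suc n) (c x) \<longleftrightarrow> (\<forall>g\<in>insert g G. g x > 0)" if "c x (Suc n) \<noteq> 0" for x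
  proof -
    \<comment> \<open>\<open>g x\<close> is also the leading coefficient of the reduct, so its
      positivity implies the nonvanishing that the induction hypothesis asks for.\<close>
    have "d x n = of_real (g x)"
      unfolding g_norm of_real_diff complex_norm_square by (simp add: d_def schur_reduct_def mult.commute)
    then show ?thesis
      using G(3)[of x] g[of x] unfolding roots_in_unit_disc_Suc_iff[of "c x", OF that]
      by (auto simp: d_def)
  qed
  moreover have "real_polynomial_function g"
    unfolding g_def
    by (intro real_polynomial_function_diff real_polynomial_function.intros(3)
        real_polynomial_function_power Suc.prems)
  ultimately show ?case
    using G(1,2) by (intro exI[of _ "insert g G"]) auto
qed

section \<open>Sign-described sets and semialgebraicity for fixed m\<close>

lemma sign_described_basic:
  assumes "finite F" "finite G" "F \<subseteq> C" "G \<subseteq> C"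
  shows "sign_described C U {x \<in> U. (\<forall>f\<in>F. f x = 0) \<and> (\<forall>g\<in>G. g x > 0)}"
  unfolding sign_described_def
proof (intro exI conjI ballI)
  let ?B = "{x \<in> U. (\<forall>f\<in>F. f x = 0) \<and> (\<forall>g\<in>G. g x > 0)}"
  show "finite {?B}" "?B = \<Union>{?B}" by simp_all
  fix B assume "B \<in> {?B}"
  then show "B = ?B" by simp
qed (use assms in auto)

lemma sign_described_Un:
  assumes "sign_described C U S" "sign_described C U T"
  shows "sign_described C U (S \<union> T)"
proof -
  let ?P = "\<lambda>B. \<exists>F G. finite F \<and> finite G \<and> F \<subseteq> C \<and> G \<subseteq> C \<and>
    B = {x \<in> U. (\<forall>f\<in>F. f x = 0) \<and> (\<forall>g\<in>G. g x > 0)}"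
  obtain \<A> where "finite \<A>" "S = \<Union>\<A>" "\<forall>B\<in>\<A>. ?P B"
    using assms(1) unfolding sign_described_def by blast
  moreover obtain \<B> where "finite \<B>" "T = \<Union>\<B>" "\<forall>B\<in>\<B>. ?P B"
    using assms(2) unfolding sign_described_def by blast
  ultimately show ?thesis
    unfolding sign_described_def by (intro exI[of _ "\<A> \<union> \<B>"]) (simp add: ball_Un)
qed

lemma complex_to_plane_image: "complex_to_plane ` A = {p. Complex (fst p) (snd p) \<in> A}"
  by (force simp: complex_to_plane_def)

lemma semialgebraic_MARS_at:
  assumes m: "m \<ge> 1"
  shows "semialgebraic_complex (MARS_at m)"
proof -
  \<comment> \<open>The coefficients are affine in the two coordinates and the leading one is 1, so
    only inequalities arise.\<close>
  define c :: "real \<times> real \<Rightarrow> nat \<Rightarrow> complex" where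
    "c p k = (if k = m then 1 else - Complex (fst p) (snd p) / of_nat m)" for p k
  have linear: "real_polynomial_function (fst :: real \<times> real \<Rightarrow> real)"
    "real_polynomial_function (snd :: real \<times> real \<Rightarrow> real)"
    by (auto intro: real_polynomial_function.intros(1) bounded_linear_fst bounded_linear_snd)
  have "real_polynomial_function (\<lambda>p. Re (c p k))" "real_polynomial_function (\<lambda>p. Im (c p k))" for k
    by (cases "k = m"; simp add: c_def;
        intro real_polynomial_function_divide real_polynomial_function_minus linear real_polynomial_function.intros(2))+
  from roots_in_unit_disc_polynomial_inequalities[of c m, OF this] obtain G where
    G: "finite G" "G \<subseteq> {f. real_polynomial_function f}"
      "\<And>p. c p m \<noteq> 0 \<longrightarrow> (roots_in_unit_disc m (c p) \<longleftrightarrow> (\<forall>g\<in>G. g p > 0))"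
    by blast
  have "(\<Sum>k\<le>m. c p k * z ^ k) = mars_poly m (Complex (fst p) (snd p)) z" for p z
  proof -
    have "(\<Sum>k\<le>m. c p k * z ^ k) = z ^ m + (\<Sum>k<m. c p k * z ^ k)"
      using m by (cases m) (auto simp: c_def lessThan_Suc_atMost)
    also have "(\<Sum>k<m. c p k * z ^ k) = - (Complex (fst p) (snd p) / of_nat m * (\<Sum>k<m. z ^ k))"
      unfolding sum_distrib_left sum_negf[symmetric] by (intro sum.cong) (auto simp: c_def)
    finally show ?thesis by (simp add: mars_poly_def)
  qed
  then have "roots_in_unit_disc m (c p) \<longleftrightarrow> Complex (fst p) (snd p) \<in> MARS_at m" for p
    by (simp add: roots_in_unit_disc_def MARS_at_iff[OF m])
  moreover have "c p m \<noteq> 0" for p by (simp add: c_def)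
  ultimately have "complex_to_plane ` MARS_at m = {p \<in> UNIV. (\<forall>f\<in>{}. f p = 0) \<and> (\<forall>g\<in>G. g p > 0)}"
    using G(3) by (auto simp: complex_to_plane_image)
  then show ?thesis
    unfolding semialgebraic_complex_def semialgebraic_def
    using sign_described_basic[of "{}" G _ UNIV] G(1,2) by simp
qed

section \<open>Semianalyticity\<close>

text \<open>Analyticity with convergence on the whole plane from every centre; all functions needed
  here have it, so radii never have to be matched.\<close>

definition entire :: "(real \<times> real \<Rightarrow> real) \<Rightarrow> bool" where
  "entire f \<longleftrightarrow> (\<forall>p. \<exists>c :: nat \<times> nat \<Rightarrow> real. \<forall>q.
     ((\<lambda>(i, j). c (i, j) * (fst q - fst p) ^ i * (snd q - snd p) ^ j) has_sum f q) UNIV)"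

lemma entire_imp_real_analytic_on: "entire f \<Longrightarrow> real_analytic_on f U"
  unfolding real_analytic_on_def
proof
  fix p assume "entire f"
  then obtain c :: "nat \<times> nat \<Rightarrow> real" where
    "\<forall>q. ((\<lambda>(i, j). c (i, j) * (fst q - fst p) ^ i * (snd q - snd p) ^ j) has_sum f q) UNIV"
    unfolding entire_def by blast
  then show "\<exists>r>0. \<exists>c :: nat \<times> nat \<Rightarrow> real. \<forall>q\<in>ball p r.
      ((\<lambda>(i, j). c (i, j) * (fst q - fst p) ^ i * (snd q - snd p) ^ j) has_sum f q) UNIV"
    by (intro exI[of _ 1] conjI exI[of _ c] ballI) (simp, blast)
qed

lemma entire_add:
  assumes "entire f" "entire g"
  shows "entire (\<lambda>x. f x + g x)"
  unfolding entire_def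
proof
  fix p
  obtain c d where
    c: "\<And>q. ((\<lambda>(i, j). c (i, j) * (fst q - fst p) ^ i * (snd q - snd p) ^ j) has_sum f q) UNIV"
    and d: "\<And>q. ((\<lambda>(i, j). d (i, j) * (fst q - fst p) ^ i * (snd q - snd p) ^ j) has_sum g q) UNIV"
    using assms unfolding entire_def by meson
  show "\<exists>e. \<forall>q. ((\<lambda>(i, j). e (i, j) * (fst q - fst p) ^ i * (snd q - snd p) ^ j)
      has_sum (f q + g q)) UNIV"
    using has_sum_add[OF c d]
    by (intro exI[of _ "\<lambda>x. c x + d x"]) (simp add: case_prod_unfold distrib_right)
qed

lemma entire_cmult:
  assumes "entire f"
  shows "entire (\<lambda>x. r * f x)"
  unfolding entire_def
proof
  fix p
  obtain c where
    c: "\<And>q. ((\<lambda>(i, j). c (i, j) * (fst q - fst p) ^ i * (snd q - snd p) ^ j) has_sum f q) UNIV"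
    using assms unfolding entire_def by meson
  show "\<exists>e. \<forall>q. ((\<lambda>(i, j). e (i, j) * (fst q - fst p) ^ i * (snd q - snd p) ^ j)
      has_sum (r * f q)) UNIV"
    using has_sum_cmult_right[OF c, of r]
    by (intro exI[of _ "\<lambda>x. r * c x"]) (simp add: case_prod_unfold mult.assoc)
qed

text \<open>Multiplication by a coordinate \<open>x = x\<^sub>0 + (x - x\<^sub>0)\<close> shifts the coefficients.\<close>

lemma entire_mult_fst:
  assumes "entire f"
  shows "entire (\<lambda>x. fst x * f x)"
  unfolding entire_def
proof
  fix p
  obtain c where
    c: "\<And>q. ((\<lambda>(i, j). c (i, j) * (fst q - fst p) ^ i * (snd q - snd p) ^ j) has_sum f q) UNIV"
    using assms unfolding entire_def by meson
  define e where "e = (\<lambda>(i, j). fst p * c (i, j) + (case i of 0 \<Rightarrow> 0 | Suc k \<Rightarrow> c (k, j)))"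
  have "((\<lambda>(i, j). e (i, j) * (fst q - fst p) ^ i * (snd q - snd p) ^ j) has_sum (fst q * f q)) UNIV"
    for q
  proof -
    define t where "t = (\<lambda>(i, j). c (i, j) * (fst q - fst p) ^ i * (snd q - snd p) ^ j)"
    \<comment> \<open>\<open>s\<close> shifts the multiplied family up by one in the first index and
      is 0 at index 0, so its sum over the range of the shift is its sum over all indices.\<close>
    define s where "s = (\<lambda>(i, j). case i of 0 \<Rightarrow> 0 | Suc k \<Rightarrow> (fst q - fst p) * t (k, j))"
    have "((s \<circ> map_prod Suc id) has_sum ((fst q - fst p) * f q)) UNIV"
      using has_sum_cmult_right[OF c, of "fst q - fst p" q]
      by (simp add: s_def t_def o_def case_prod_unfold)
    then have "(s has_sum ((fst q - fst p) * f q)) (range (map_prod Suc id))"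
      by (subst has_sum_reindex) (auto simp: inj_on_def)
    then have "(s has_sum ((fst q - fst p) * f q)) UNIV"
      by (rule has_sum_cong_neutral[THEN iffD1, rotated -1])
        (auto simp: s_def image_iff split: nat.splits)
    from has_sum_add[OF has_sum_cmult_right[OF c, of "fst p" q] this]
    have "((\<lambda>x. fst p * t x + s x) has_sum (fst q * f q)) UNIV"
      by (simp add: t_def algebra_simps)
    moreover have "fst p * t x + s x = (case x of (i, j) \<Rightarrow> e (i, j) * (fst q - fst p) ^ i * (snd q - snd p) ^ j)"
      for x
      by (cases x) (auto simp: e_def s_def t_def algebra_simps split: nat.splits)
    ultimately show ?thesis by simp
  qed
  then show "\<exists>e. \<forall>q. ((\<lambda>(i, j). e (i, j) * (fst q - fst p) ^ i * (snd q - snd p) ^ j)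
      has_sum (fst q * f q)) UNIV" by blast
qed

lemma entire_swap:
  assumes "entire f"
  shows "entire (f \<circ> prod.swap)"
  unfolding entire_def
proof
  fix p :: "real \<times> real"
  obtain c where
    c: "\<And>q. ((\<lambda>(i, j). c (i, j) * (fst q - snd p) ^ i * (snd q - fst p) ^ j) has_sum f q) (UNIV \<times> UNIV)"
    using assms[unfolded entire_def, THEN spec, of "prod.swap p"]
    unfolding fst_swap snd_swap UNIV_Times_UNIV by blast
  show "\<exists>e. \<forall>q. ((\<lambda>(i, j). e (i, j) * (fst q - fst p) ^ i * (snd q - snd p) ^ j)
      has_sum ((f \<circ> prod.swap) q)) UNIV"
  proof (intro exI[of _ "\<lambda>(i, j). c (j, i)"] allI)
    fix q
    show "((\<lambda>(i, j). (case (i, j) of (i, j) \<Rightarrow> c (j, i)) * (fst q - fst p) ^ i * (snd q - snd p) ^ j)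
        has_sum ((f \<circ> prod.swap) q)) UNIV"
      using has_sum_swap[THEN iffD1, OF c[of "prod.swap q"]] by (simp add: case_prod_unfold mult_ac)
  qed
qed

lemma entire_mult_snd:
  assumes "entire f"
  shows "entire (\<lambda>x. snd x * f x)"
  using entire_swap[OF entire_mult_fst[OF entire_swap[OF assms]]] by (simp add: o_def)

lemma entire_power_series_snd:
  assumes "\<And>y0. \<exists>b :: nat \<Rightarrow> real. \<forall>y. ((\<lambda>j. b j * (y - y0) ^ j) has_sum g y) UNIV"
  shows "entire (\<lambda>x. g (snd x))"
  unfolding entire_def
proof
  fix p :: "real \<times> real"
  obtain b :: "nat \<Rightarrow> real" where b: "\<And>y. ((\<lambda>j. b j * (y - snd p) ^ j) has_sum g y) UNIV"
    using assms by blast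
  define c where "c = (\<lambda>(i, j). if i = (0::nat) then b j else 0)"
  have "((\<lambda>(i, j). c (i, j) * (fst q - fst p) ^ i * (snd q - snd p) ^ j) has_sum g (snd q)) UNIV" for q
  proof -
    have "((\<lambda>(i, j). c (i, j) * (fst q - fst p) ^ i * (snd q - snd p) ^ j) has_sum g (snd q)) (range (Pair 0))"
      using b[of "snd q"] by (subst has_sum_reindex) (auto simp: inj_on_def o_def c_def)
    then show ?thesis
      by (rule has_sum_cong_neutral[THEN iffD1, rotated -1]) (auto simp: c_def)
  qed
  then show "\<exists>c. \<forall>q. ((\<lambda>(i, j). c (i, j) * (fst q - fst p) ^ i * (snd q - snd p) ^ j)
      has_sum g (snd q)) UNIV" by blast
qed

lemma entire_const: "entire (\<lambda>x. r)"
proof (rule entire_power_series_snd)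
  fix y0 :: real
  have "((\<lambda>j. (if j = 0 then r else 0) * (y - y0) ^ j) has_sum r) UNIV" for y
    by (rule has_sum_finite_neutralI[of "{0}"]) auto
  then show "\<exists>b. \<forall>y. ((\<lambda>j. b j * (y - y0) ^ j) has_sum r) UNIV"
    by (intro exI[of _ "\<lambda>j. if j = 0 then r else 0"] allI)
qed

lemma sin_cos_coeff_has_sum:
  fixes y :: real
  shows "((\<lambda>j. sin_coeff j * y ^ j) has_sum sin y) UNIV" "((\<lambda>j. cos_coeff j * y ^ j) has_sum cos y) UNIV"
  using norm_summable_imp_has_sum[OF summable_norm_sin sin_converges, of y]
    norm_summable_imp_has_sum[OF summable_norm_cos cos_converges, of y] by simp_all

lemma entire_sin_snd: "entire (\<lambda>x. sin (snd x))"
proof (rule entire_power_series_snd)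
  fix y0 :: real
  \<comment> \<open>The addition theorem moves the centre of expansion from 0 to y0.\<close>
  have "((\<lambda>j. sin y0 * (cos_coeff j * (y - y0) ^ j) + cos y0 * (sin_coeff j * (y - y0) ^ j))
      has_sum (sin y0 * cos (y - y0) + cos y0 * sin (y - y0))) UNIV" for y
    by (intro has_sum_add has_sum_cmult_right sin_cos_coeff_has_sum)
  moreover have "sin y0 * cos (y - y0) + cos y0 * sin (y - y0) = sin y" for y
    using sin_add[of y0 "y - y0"] by simp
  ultimately show "\<exists>b. \<forall>y. ((\<lambda>j. b j * (y - y0) ^ j) has_sum sin y) UNIV"
    by (intro exI[of _ "\<lambda>j. sin y0 * cos_coeff j + cos y0 * sin_coeff j"]) (simp add: algebra_simps)
qed

lemma entire_cos_snd: "entire (\<lambda>x. cos (snd x))"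
proof (rule entire_power_series_snd)
  fix y0 :: real
  have "((\<lambda>j. cos y0 * (cos_coeff j * (y - y0) ^ j) + (- sin y0) * (sin_coeff j * (y - y0) ^ j))
      has_sum (cos y0 * cos (y - y0) + (- sin y0) * sin (y - y0))) UNIV" for y
    by (intro has_sum_add has_sum_cmult_right sin_cos_coeff_has_sum)
  moreover have "cos y0 * cos (y - y0) + (- sin y0) * sin (y - y0) = cos y" for y
    using cos_add[of y0 "y - y0"] by simp
  ultimately show "\<exists>b. \<forall>y. ((\<lambda>j. b j * (y - y0) ^ j) has_sum cos y) UNIV"
    by (intro exI[of _ "\<lambda>j. cos y0 * cos_coeff j + (- sin y0) * sin_coeff j"])
      (simp add: algebra_simps)
qed

text \<open>One global description serves at every point: \<open>A\<close>, \<open>B\<close> and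
  \<open>D\<close> are the parts of \<open>MARS\<close> on the real axis, above it and below
  it.\<close>

lemma semianalytic_MARS: "semianalytic_complex MARS"
proof -
  define d where "d x = snd x * cos (snd x) + (- 1) * (fst x * sin (snd x))" for x :: "real \<times> real"
  let ?C = "{f. real_analytic_on f UNIV}"
  have C: "f \<in> ?C" if "entire f" for f
    using entire_imp_real_analytic_on[OF that] by simp
  have d: "entire d"
    unfolding d_def
    by (intro entire_add entire_mult_snd entire_cmult entire_mult_fst entire_sin_snd entire_cos_snd)
  have fst: "entire fst" and snd: "entire snd"
    using entire_mult_fst[OF entire_const[of 1]] entire_mult_snd[OF entire_const[of 1]] by simp_all
  define A where "A = {x \<in> UNIV. (\<forall>f\<in>{snd}. f x = 0) \<and> (\<forall>g\<in>{\<lambda>x::real\<times>real. 1 + (- 1) * fst x}. g x > 0)}"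
  define B where "B = {x \<in> UNIV. (\<forall>f\<in>{}. f x = (0::real)) \<and> (\<forall>g\<in>{snd, \<lambda>x::real\<times>real. pi + (- 1) * snd x, d}. g x > 0)}"
  define D where "D = {x \<in> UNIV. (\<forall>f\<in>{}. f x = (0::real)) \<and>
    (\<forall>g\<in>{\<lambda>x::real\<times>real. (- 1) * snd x, \<lambda>x. pi + snd x, \<lambda>x. (- 1) * d x}. g x > 0)}"
  have "sign_described ?C UNIV A" "sign_described ?C UNIV B" "sign_described ?C UNIV D"
    unfolding A_def B_def D_def
    by (intro sign_described_basic finite.intros insert_subsetI empty_subsetI C entire_add entire_cmult
        entire_const d fst snd)+
  then have "sign_described ?C UNIV (A \<union> (B \<union> D))"
    by (intro sign_described_Un)
  moreover have "complex_to_plane ` MARS = A \<union> (B \<union> D)"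
    by (auto simp: complex_to_plane_image MARS_iff_Cartesian A_def B_def D_def d_def)
  ultimately show ?thesis
    unfolding semianalytic_complex_def semianalytic_def by (intro allI exI[of _ UNIV]) simp
qed

section \<open>Transcendence of the boundary\<close>

lemma real_polynomial_function_affine_line:
  fixes f :: "'a::real_normed_vector \<Rightarrow> real"
  assumes "real_polynomial_function f"
  shows "real_polynomial_function (\<lambda>t::real. f (a + t *\<^sub>R b))"
proof -
  have "polynomial_function (\<lambda>t::real. a + t *\<^sub>R b)"
    by (intro polynomial_function_add polynomial_function_const polynomial_function_bounded_linear
        bounded_linear_scaleR_left)
  from real_polynomial_function_compose[OF this assms] show ?thesis by (simp add: o_def)
qed

lemma finite_zeros_real_polynomial_function:
  fixes f :: "real \<Rightarrow> real"
  assumes "real_polynomial_function f" "f s \<noteq> 0"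
  shows "finite {t. f t = 0}"
proof -
  obtain a n where f: "f = (\<lambda>x. \<Sum>i\<le>n. a i * x ^ i)"
    using assms(1) real_polynomial_function_iff_sum by blast
  have "\<not> (\<forall>i\<le>n. a i = 0)"
  proof
    assume "\<forall>i\<le>n. a i = 0"
    then have "f s = 0" by (simp add: f)
    with assms(2) show False ..
  qed
  then obtain k where "a k \<noteq> 0" "k \<le> n" by blast
  then show ?thesis unfolding f using polyfun_finite_roots[of a n] by blast
qed

text \<open>Restrict to the line through \<open>p\<close> and \<open>q\<close>.\<close>

lemma real_polynomial_function_common_nonzero:
  fixes f g :: "'a::real_normed_vector \<Rightarrow> real"
  assumes "real_polynomial_function f" "real_polynomial_function g" "f p \<noteq> 0" "g q \<noteq> 0"
  shows "\<exists>r. f r \<noteq> 0 \<and> g r \<noteq> 0"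
proof -
  have "finite {t::real. f (p + t *\<^sub>R (q - p)) = 0}"
    using assms by (intro finite_zeros_real_polynomial_function[of _ 0]
        real_polynomial_function_affine_line) auto
  moreover have "finite {t::real. g (p + t *\<^sub>R (q - p)) = 0}"
    using assms by (intro finite_zeros_real_polynomial_function[of _ 1]
        real_polynomial_function_affine_line) auto
  ultimately have "finite ({t::real. f (p + t *\<^sub>R (q - p)) = 0} \<union> {t. g (p + t *\<^sub>R (q - p)) = 0})"
    by simp
  then obtain t where "t \<notin> {t::real. f (p + t *\<^sub>R (q - p)) = 0} \<union> {t. g (p + t *\<^sub>R (q - p)) = 0}"
    using ex_new_if_finite[OF infinite_UNIV_char_0] by blast
  then show ?thesis by blast
qed

lemma real_polynomial_function_prod_nonzero:
  fixes F :: "('a::real_normed_vector \<Rightarrow> real) set"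
  assumes "finite F" "\<And>f. f \<in> F \<Longrightarrow> real_polynomial_function f" "\<And>f. f \<in> F \<Longrightarrow> \<exists>p. f p \<noteq> 0"
  shows "\<exists>p. (\<Prod>f\<in>F. f p) \<noteq> 0"
  using assms
proof (induction F)
  case (insert f F)
  have "real_polynomial_function (\<lambda>p. \<Prod>f\<in>F. f p)"
    using insert by (intro real_polynomial_function_prod) auto
  moreover obtain p q where "f p \<noteq> 0" "(\<Prod>f\<in>F. f q) \<noteq> 0" using insert by blast
  ultimately obtain r where "f r \<noteq> 0" "(\<Prod>f\<in>F. f r) \<noteq> 0"
    using real_polynomial_function_common_nonzero[of f "\<lambda>p. \<Prod>f\<in>F. f p"] insert.prems(1) by blast
  then show ?case using insert.hyps by (intro exI[of _ r]) simp
qed auto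

text \<open>Multiplying by \<open>sin y ^ N\<close> removes the poles of \<open>f (y cot y, y)\<close>.\<close>

lemma real_polynomial_function_cot_curve_entire:
  fixes f :: "real \<times> real \<Rightarrow> real"
  assumes "real_polynomial_function f"
  shows "\<exists>N h. h holomorphic_on UNIV \<and>
    (\<forall>y. sin y \<noteq> 0 \<longrightarrow> h (complex_of_real y) = of_real (sin y ^ N * f (y * cot y, y)))"
  using assms
proof (induction f rule: real_polynomial_function.induct)
  case (linear f)
  \<comment> \<open>On the curve, sin y times the linear form f is this entire function of
    y.\<close>
  define h where "h z = of_real (f (1, 0)) * z * cos z + of_real (f (0, 1)) * z * sin z" for z :: complex
  have f: "f (x, y) = x * f (1, 0) + y * f (0, 1)" for x y
  proof -
    have "f (x, y) = f (x *\<^sub>R (1, 0) + y *\<^sub>R (0, 1))" by simp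
    also have "\<dots> = x *\<^sub>R f (1, 0) + y *\<^sub>R f (0, 1)"
      using bounded_linear.linear[OF linear] by (simp only: linear_add linear_scale)
    finally show ?thesis by simp
  qed
  have "h (of_real y) = of_real (sin y ^ 1 * f (y * cot y, y))" if "sin y \<noteq> 0" for y
    using that unfolding f[of "y * cot y"] h_def cos_of_real sin_of_real
    by (simp add: cot_def algebra_simps)
  moreover have "h holomorphic_on UNIV"
    unfolding h_def by (intro holomorphic_intros)
  ultimately show ?case by blast
next
  case (const c)
  show ?case by (intro exI[of _ 0] exI[of _ "\<lambda>_. of_real c"]) auto
next
  case (add f g)
  then obtain M h N k where h: "h holomorphic_on UNIV" "k holomorphic_on UNIV"
    "\<And>y. sin y \<noteq> 0 \<Longrightarrow> h (complex_of_real y) = of_real (sin y ^ M * f (y * cot y, y))"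
    "\<And>y. sin y \<noteq> 0 \<Longrightarrow> k (complex_of_real y) = of_real (sin y ^ N * g (y * cot y, y))"
    by blast
  define l where "l z = sin z ^ N * h z + sin z ^ M * k z" for z
  have "l (of_real y) = of_real (sin y ^ (M + N) * (f (y * cot y, y) + g (y * cot y, y)))"
    if "sin y \<noteq> 0" for y
    unfolding l_def h(3,4)[OF that] sin_of_real by (simp add: power_add algebra_simps)
  moreover have "l holomorphic_on UNIV"
    unfolding l_def by (intro holomorphic_intros h)
  ultimately show ?case by blast
next
  case (mult f g)
  then obtain M h N k where h: "h holomorphic_on UNIV" "k holomorphic_on UNIV"
    "\<And>y. sin y \<noteq> 0 \<Longrightarrow> h (complex_of_real y) = of_real (sin y ^ M * f (y * cot y, y))"
    "\<And>y. sin y \<noteq> 0 \<Longrightarrow> k (complex_of_real y) = of_real (sin y ^ N * g (y * cot y, y))"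
    by blast
  define l where "l z = h z * k z" for z
  have "l (of_real y) = of_real (sin y ^ (M + N) * (f (y * cot y, y) * g (y * cot y, y)))"
    if "sin y \<noteq> 0" for y
    unfolding l_def h(3,4)[OF that] by (simp add: power_add algebra_simps)
  moreover have "l holomorphic_on UNIV"
    unfolding l_def by (intro holomorphic_intros h)
  ultimately show ?case by blast
qed

text \<open>
  Transcendence of the curve \<open>x = y cot y\<close>: by analytic continuation \<open>f\<close> vanishes on its branches
  over all of the real line, and each line \<open>x = y cot v\<close> meets these infinitely often.
\<close>

lemma real_polynomial_function_zero_on_cot_curve:
  fixes f :: "real \<times> real \<Rightarrow> real"
  assumes f: "real_polynomial_function f"
    and zero: "\<And>y. 0 < y \<Longrightarrow> y < pi \<Longrightarrow> f (y * cot y, y) = 0"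
  shows "f p = 0"
proof -
  obtain N h where h: "h holomorphic_on UNIV"
    "\<And>y. sin y \<noteq> 0 \<Longrightarrow> h (complex_of_real y) = of_real (sin y ^ N * f (y * cot y, y))"
    using real_polynomial_function_cot_curve_entire[OF f] by blast
  \<comment> \<open>Any point of the interval would do as an accumulation point of zeros of
    \<open>h\<close>.\<close>
  have "1 islimpt {0<..<pi}"
    using pi_gt3 by (intro interior_limit_point) (auto simp: interior_open)
  then have "complex_of_real 1 islimpt complex_of_real ` {0<..<pi}"
    by (rule islimpt_isCont_image) (auto simp: eventually_at_filter)
  moreover have "h z = 0" if "z \<in> complex_of_real ` {0<..<pi}" for z
    using that h(2) zero sin_gt_zero by auto force
  ultimately have h0: "h z = 0" for z
    using analytic_continuation[OF h(1) open_UNIV connected_UNIV, of "complex_of_real ` {0<..<pi}" "of_real 1" z]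
    by simp
  have curve: "f (y * cot y, y) = 0" if "sin y \<noteq> 0" for y
    using h(2)[OF that] h0 that by simp
  have off_axis: "f (x, y) = 0" if "y \<noteq> 0" for x y
  proof -
    \<comment> \<open>v is the angle in (0, pi) with cot v = x / y.\<close>
    define v where "v = arctan (- (x / y)) + pi / 2"
    have v: "0 < v" "v < pi" using arctan_bounded[of "- (x / y)"] by (auto simp: v_def)
    have "sin v = cos (arctan (- (x / y)))" "cos v = - sin (arctan (- (x / y)))"
      by (simp_all add: v_def sin_add cos_add)
    moreover have "sin (arctan (- (x / y))) = - (x / y) * cos (arctan (- (x / y)))"
      using tan_arctan[of "- (x / y)"] cos_arctan_not_zero[of "- (x / y)"]
      by (simp add: tan_def field_simps del: arctan_minus)
    ultimately have "cot v = x / y"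
      using cos_arctan_not_zero[of "- (x / y)"] by (simp add: cot_def)
    \<comment> \<open>cot has period pi, so these curve points all lie on the line spanned by (cot
      v, 1), where f is a polynomial in one variable.\<close>
    have "f ((v + real n * pi) * cot v, v + real n * pi) = 0" for n
    proof -
      have "sin (v + real n * pi) = (-1) ^ n * sin v" "cos (v + real n * pi) = (-1) ^ n * cos v"
        by (simp_all add: sin_add cos_add)
      then show ?thesis
        using curve[of "v + real n * pi"] sin_gt_zero[OF v] by (simp add: cot_def)
    qed
    then have "range (\<lambda>n. v + real n * pi) \<subseteq> {t. f (0 + t *\<^sub>R (cot v, 1)) = 0}" by auto
    moreover have "infinite (range (\<lambda>n. v + real n * pi))"
      by (rule range_inj_infinite) (auto simp: inj_def)
    ultimately have "f (0 + y *\<^sub>R (cot v, 1)) = 0"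
      using finite_zeros_real_polynomial_function[OF real_polynomial_function_affine_line[OF f, of 0 "(cot v, 1)"]]
        finite_subset by blast
    then show ?thesis using \<open>cot v = x / y\<close> that by simp
  qed
  \<comment> \<open>On the axis y = 0 the zeros are carried over from y > 0 along vertical
    lines.\<close>
  have "f (x, 0) = 0" for x
  proof (rule ccontr)
    assume "f (x, 0) \<noteq> 0"
    then have "finite {t. f ((x, 0) + t *\<^sub>R (0, 1)) = 0}"
      by (intro finite_zeros_real_polynomial_function[of _ 0] real_polynomial_function_affine_line f) simp
    moreover have "{0<..} \<subseteq> {t. f ((x, 0) + t *\<^sub>R (0, 1)) = 0}" using off_axis by auto
    ultimately show False using infinite_Ioi[of "0::real"] finite_subset by blast
  qed
  with off_axis show ?thesis by (cases p; cases "snd p = 0") auto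
qed

text \<open>
  At a point where no describing polynomial vanishes, all of them keep their sign nearby.
\<close>

lemma semialgebraic_boundary_polynomial:
  assumes "semialgebraic S"
  obtains f where "real_polynomial_function f" "\<exists>p. f p \<noteq> 0"
    "\<And>p. f p \<noteq> 0 \<Longrightarrow> \<exists>e>0. \<forall>q\<in>ball p e. q \<in> S \<longleftrightarrow> p \<in> S"
proof -
  obtain \<B> where \<B>: "finite \<B>" "S = \<Union>\<B>" "\<forall>B\<in>\<B>. \<exists>F G. finite F \<and> finite G \<and>
      F \<subseteq> {f. real_polynomial_function f} \<and> G \<subseteq> {f. real_polynomial_function f} \<and>
      B = {x \<in> UNIV. (\<forall>f\<in>F. f x = 0) \<and> (\<forall>g\<in>G. g x > 0)}"
    using assms unfolding semialgebraic_def sign_described_def by blast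
  from bchoice[OF \<B>(3)] obtain F where "\<forall>B\<in>\<B>. \<exists>G. finite (F B) \<and> finite G \<and>
      F B \<subseteq> {f. real_polynomial_function f} \<and> G \<subseteq> {f. real_polynomial_function f} \<and>
      B = {x \<in> UNIV. (\<forall>f\<in>F B. f x = 0) \<and> (\<forall>g\<in>G. g x > 0)}" ..
  from bchoice[OF this] obtain G where FG: "\<forall>B\<in>\<B>. finite (F B) \<and> finite (G B) \<and>
      F B \<subseteq> {f. real_polynomial_function f} \<and> G B \<subseteq> {f. real_polynomial_function f} \<and>
      B = {x \<in> UNIV. (\<forall>f\<in>F B. f x = 0) \<and> (\<forall>g\<in>G B. g x > 0)}" ..
  \<comment> \<open>Identically zero polynomials are dropped, as they would kill the product; their
    sign is constant anyway.\<close>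
  define H where "H = {f \<in> (\<Union>B\<in>\<B>. F B \<union> G B). \<exists>p. f p \<noteq> 0}"
  have H: "finite H" "\<And>f. f \<in> H \<Longrightarrow> real_polynomial_function f"
    using \<B>(1) FG unfolding H_def by (simp, blast)
  show thesis
  proof (rule that)
    show "real_polynomial_function (\<lambda>p. \<Prod>f\<in>H. f p)"
      using H by (intro real_polynomial_function_prod) auto
    show "\<exists>p. (\<Prod>f\<in>H. f p) \<noteq> 0"
      using H by (intro real_polynomial_function_prod_nonzero) (auto simp: H_def)
    fix p :: "real \<times> real" assume "(\<Prod>f\<in>H. f p) \<noteq> 0"
    then have nonzero: "f p \<noteq> 0" if "f \<in> H" for f using that H(1) by auto
    have "\<forall>\<^sub>F q in nhds p. sgn (f q) = sgn (f p)" if "f \<in> H" for f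
    proof -
      have lim: "(f \<longlongrightarrow> f p) (nhds p)"
        using continuous_real_polymonial_function[OF H(2)[OF that], of p]
        by (simp add: continuous_at tendsto_nhds_iff)
      show ?thesis
      proof (cases "f p > 0")
        case True
        then show ?thesis
          using order_tendstoD(1)[OF lim, of 0] by (auto elim: eventually_mono)
      next
        case False
        then have "f p < 0" using nonzero[OF that] by simp
        then show ?thesis
          using order_tendstoD(2)[OF lim, of 0] by (auto elim: eventually_mono)
      qed
    qed
    then have "\<forall>\<^sub>F q in nhds p. \<forall>f\<in>H. sgn (f q) = sgn (f p)"
      using H(1) by (simp add: eventually_ball_finite)
    then obtain e where e: "e > 0" "\<And>q. dist q p < e \<Longrightarrow> \<forall>f\<in>H. sgn (f q) = sgn (f p)"
      unfolding eventually_nhds_metric by blast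
    have "q \<in> S \<longleftrightarrow> p \<in> S" if q: "q \<in> ball p e" for q
    proof -
      have sgn: "sgn (f q) = sgn (f p)" if "f \<in> F B \<union> G B" "B \<in> \<B>" for f B
      proof (cases "f \<in> H")
        case True
        then show ?thesis using e(2)[of q] q by (simp add: dist_commute)
      next
        case False
        then have "f x = 0" for x using that unfolding H_def by blast
        then show ?thesis by simp
      qed
      have "q \<in> B \<longleftrightarrow> p \<in> B" if B: "B \<in> \<B>" for B
      proof -
        have "f q = 0 \<longleftrightarrow> f p = 0" if "f \<in> F B" for f
          using sgn[OF _ B, of f] that by (metis UnI1 sgn_0_0)
        moreover have "f q > 0 \<longleftrightarrow> f p > 0" if "f \<in> G B" for f
          using sgn[OF _ B, of f] that by (metis UnI2 sgn_1_pos sgn_greater)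
        moreover have "x \<in> B \<longleftrightarrow> (\<forall>f\<in>F B. f x = 0) \<and> (\<forall>g\<in>G B. g x > 0)" for x
          using bspec[OF FG B] by blast
        ultimately show ?thesis by simp
      qed
      then show ?thesis by (simp add: \<B>(2))
    qed
    with e(1) show "\<exists>e>0. \<forall>q\<in>ball p e. q \<in> S \<longleftrightarrow> p \<in> S" by blast
  qed
qed

text \<open>The points (y cot y, y) with 0 < y < pi lie on the boundary of \<open>MARS\<close>, so a
  polynomial that vanishes wherever membership is not locally constant vanishes on this curve, hence
  everywhere.\<close>

lemma not_semialgebraic_MARS: "\<not> semialgebraic_complex MARS"
proof
  assume "semialgebraic_complex MARS"
  then obtain f where f: "real_polynomial_function f" "\<exists>p. f p \<noteq> 0"
    "\<And>p. f p \<noteq> 0 \<Longrightarrow> \<exists>e>0. \<forall>q\<in>ball p e. q \<in> complex_to_plane ` MARS \<longleftrightarrow> p \<in> complex_to_plane ` MARS"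
    unfolding semialgebraic_complex_def by (rule semialgebraic_boundary_polynomial) blast
  have "f (y * cot y, y) = 0" if y: "0 < y" "y < pi" for y
  proof (rule ccontr)
    assume "f (y * cot y, y) \<noteq> 0"
    from f(3)[OF this] obtain e where e: "e > 0"
      "\<And>q. q \<in> ball (y * cot y, y) e \<Longrightarrow> q \<in> complex_to_plane ` MARS \<longleftrightarrow> (y * cot y, y) \<in> complex_to_plane ` MARS"
      by blast
    have sin: "sin y > 0" using sin_gt_zero[OF y] .
    have in_iff: "(x, y) \<in> complex_to_plane ` MARS \<longleftrightarrow> x < y * cot y" for x
      using y sin by (simp add: complex_to_plane_image MARS_iff_Cartesian cot_def field_simps)
    \<comment> \<open>The point e / 2 to the left lies in \<open>MARS\<close>, the curve point does
      not.\<close>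
    have "(y * cot y - e / 2, y) \<in> ball (y * cot y, y) e"
      using e(1) by (simp add: dist_Pair_Pair dist_real_def)
    from e(2)[OF this] show False using e(1) by (simp add: in_iff)
  qed
  with real_polynomial_function_zero_on_cot_curve[OF f(1)] f(2) show False by blast
qed

section \<open>The six assertions together\<close>

theorem proposition6p4:
  fixes m :: nat
  assumes "m \<ge> 1"
  shows "(MARS_at m \<inter> complex_of_real ` {0..} = complex_of_real ` {0..<1}) \<and>
    (complex_of_real ` {- real m<..<0} \<subseteq> MARS_at m \<and> complex_of_real ` {..<0} \<subseteq> MARS) \<and>
    (MARS \<subseteq> {z. Re z < 1}) \<and>
    (MARS_minus m = {cnj a | a. a \<in> MARS_plus m}) \<and>
    open (MARS_at m) \<and>
    (semialgebraic_complex (MARS_at m) \<and>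
      semianalytic_complex MARS \<and> \<not> semialgebraic_complex MARS)"
proof (intro conjI)
  show "MARS_at m \<inter> complex_of_real ` {0..} = complex_of_real ` {0..<1}"
    using MARS_at_nonneg_iff[OF assms] by auto
  show "complex_of_real ` {- real m<..<0} \<subseteq> MARS_at m"
    using MARS_at_neg[OF assms] by auto
  show "complex_of_real ` {..<0} \<subseteq> MARS"
    by (auto simp: of_real_in_MARS_iff)
  show "MARS \<subseteq> {z. Re z < 1}"
    using Re_MARS_at_less by (auto simp: MARS_def)
  show "MARS_minus m = {cnj a | a. a \<in> MARS_plus m}"
  proof (intro equalityI subsetI)
    fix a assume "a \<in> MARS_minus m"
    then have "cnj a \<in> MARS_plus m" "a = cnj (cnj a)"
      using cnj_MARS_at_iff[OF assms] by (auto simp: MARS_minus_def MARS_plus_def)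
    then show "a \<in> {cnj a | a. a \<in> MARS_plus m}" by blast
  qed (use cnj_MARS_at_iff[OF assms] in \<open>auto simp: MARS_minus_def MARS_plus_def\<close>)
qed (use assms in \<open>simp_all add: open_MARS_at semialgebraic_MARS_at semianalytic_MARS not_semialgebraic_MARS\<close>)

end
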